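(* Let $m,n\ge 1$ be integers and let $E\subset\mathbb{R}^n$ be a closed subset containing the origin. Then the ideal $I^m(E)\lhd\mathcal{P}_0^m(\mathbb{R}^n)$ is closed, i.e. $I^m(E)=cl(I^m(E))$: every jet $p\in\mathcal{P}_0^m(\mathbb{R}^n)$ that is implied by $I^m(E)$ belongs to $I^m(E)$.
   Context: Jets: for $f\in C^m(\mathbb{R}^n)$ (real valued), $J^m(f)$ is its Taylor polynomial of degree at most $m$ at the origin. $\mathcal{P}^m(\mathbb{R}^n)$ is the ring of real polynomials in $n$ variables of degree at most $m$, with multiplication of $P$ and $Q$ given by $J^m(PQ)$ (truncated product). $\mathcal{P}_0^m(\mathbb{R}^n)\subset\mathcal{P}^m(\mathbb{R}^n)$ is the set of those with zero constant term. For a closed set $E\subset\mathbb{R}^n$ containing the origin, $I^m(E):=\{J^m(f): f\in C^m(\mathbb{R}^n),\ f|_E=0\}$; it is an ideal of $\mathcal{P}^m(\mathbb{R}^n)$ contained in $\mathcal{P}_0^m(\mathbb{R}^n)$. Geometry: $\mathrm{dist}(x,Y)=\inf_{y\in Y}|x-y|$ for $Y\ne\emptyset$ and $\mathrm{dist}(x,\emptyset)=+\infty$. For $\omega\in S^{n-1}$, $\delta,r>0$: $\Gamma(\omega,\delta,r)=\{x\in\mathbb{R}^n: 0<|x|<r,\ |x/|x|-\omega|<\delta\}$. For $K\ge 1$, $\rho>0$: $\mathrm{Ann}_K(\rho)=\{x\in\mathbb{R}^n:\rho/K<|x|<K\rho\}$. Allowed directions: let $I$ be an ideal of $\mathcal{P}^m(\mathbb{R}^n)$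 contained in $\mathcal{P}_0^m(\mathbb{R}^n)$. A direction $\omega\in S^{n-1}$ is forbidden for $I$ if there exist $p_1,\dots,p_L\in I$ and $c,\delta,r>0$ such that $|p_1(x)|+\dots+|p_L(x)|>c|x|^m$ for all $x\in\Gamma(\omega,\delta,r)$; otherwise it is allowed. $Allow(I)\subset S^{n-1}$ is the set of allowed directions. Implied jets: with $\Omega:=Allow(I)$, the ideal $I$ implies $p\in\mathcal{P}_0^m(\mathbb{R}^n)$ if there exist $A>0$ and $Q_1,\dots,Q_L\in I$ such that: for any $\epsilon>0$ there exist $\delta,r>0$ such that for any $0<\rho\le r$ there exist $F,S_1,\dots,S_L\in C^m(\mathrm{Ann}_4(\rho))$ with (i) $|\partial^\alpha F(x)|\le\epsilon\rho^{m-|\alpha|}$ for all $x\in\mathrm{Ann}_4(\rho)$, $|\alpha|\le m$; (ii) $|\partial^\alpha S_l(x)|\le A\rho^{-|\alpha|}$ for all $x\in\mathrm{Ann}_4(\rho)$, $|\alpha|\le m$, $1\le l\le L$; (iii) $p(x)=F(x)+\sum_{l=1}^L S_l(x)Q_l(x)$ (ordinary products of functions) for all $x\in\mathrm{Ann}_2(\rho)$ with $\mathrm{dist}(x/|x|,\Omega)<\delta$. The closure is $cl(I):=\{p\in\mathcal{P}_0^m(\mathbb{R}^n): I\text{ implies }p\}$, and $I$ is closed if $I=cl(I)$ (one always has $I\subset cl(I)$). *)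

theory Defs
  imports "HOL-Analysis.Analysis"
begin

definition partial_deriv :: "'n::finite \<Rightarrow> (real^'n \<Rightarrow> real) \<Rightarrow> real^'n \<Rightarrow> real" where
  "partial_deriv i f x = deriv (\<lambda>t. f (x + t *\<^sub>R axis i 1)) 0"

text \<open>All iterated partial derivatives of order at most \<open>m\<close> exist and are continuous on \<open>U\<close>.
  This is only meant for open \<open>U\<close>, where it depends only on the values of \<open>f\<close> on \<open>U\<close>.\<close>

primrec Cm_on :: "nat \<Rightarrow> (real^'n::finite) set \<Rightarrow> (real^'n \<Rightarrow> real) \<Rightarrow> bool" where
  "Cm_on 0 U f \<longleftrightarrow> continuous_on U f"
| "Cm_on (Suc m) U f \<longleftrightarrow> continuous_on U f \<and>
     (\<forall>i. (\<forall>x\<in>U. (\<lambda>t. f (x + t *\<^sub>R axis i 1)) field_differentiable (at 0)) \<and>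
          Cm_on m U (partial_deriv i f))"

definition multi_indices :: "nat \<Rightarrow> ('n::finite \<Rightarrow> nat) set" where
  "multi_indices m = {\<alpha>. (\<Sum>i\<in>UNIV. \<alpha> i) \<le> m}"

text \<open>The type \<open>'n\<close> carries no order, so the order in which the partial derivatives are taken is
  chosen arbitrarily: \<open>is\<close> is a list containing each index \<open>i\<close> exactly \<open>\<alpha> i\<close> times. For \<open>f\<close> of
  class C^m and \<open>\<alpha>\<close> of order at most \<open>m\<close> the result does not depend on the choice.\<close>

definition multi_deriv :: "('n::finite \<Rightarrow> nat) \<Rightarrow> (real^'n \<Rightarrow> real) \<Rightarrow> real^'n \<Rightarrow> real" where
  "multi_deriv \<alpha> f = foldr partial_deriv (SOME is. \<forall>i. count_list is i = \<alpha> i) f"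

definition monomial :: "('n::finite \<Rightarrow> nat) \<Rightarrow> real^'n \<Rightarrow> real" where
  "monomial \<alpha> x = (\<Prod>i\<in>UNIV. x $ i ^ \<alpha> i)"

text \<open>Real polynomials are identified with the polynomial functions they induce.\<close>

definition polys :: "nat \<Rightarrow> (real^'n::finite \<Rightarrow> real) set" where
  "polys m = {\<lambda>x. \<Sum>\<alpha>\<in>multi_indices m. c \<alpha> * monomial \<alpha> x | c. True}"

text \<open>The constant term of \<open>p\<close> is \<open>p 0\<close>.\<close>

definition polys0 :: "nat \<Rightarrow> (real^'n::finite \<Rightarrow> real) set" where
  "polys0 m = {p \<in> polys m. p 0 = 0}"

definition jet :: "nat \<Rightarrow> (real^'n::finite \<Rightarrow> real) \<Rightarrow> real^'n \<Rightarrow> real" where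
  "jet m f = (\<lambda>x. \<Sum>\<alpha>\<in>multi_indices m.
     multi_deriv \<alpha> f 0 / (\<Prod>i\<in>UNIV. fact (\<alpha> i)) * monomial \<alpha> x)"

definition vanishing_jets :: "nat \<Rightarrow> (real^'n::finite) set \<Rightarrow> (real^'n \<Rightarrow> real) set" where
  "vanishing_jets m E = {jet m f | f. Cm_on m UNIV f \<and> (\<forall>x\<in>E. f x = 0)}"

text \<open>\<open>infdist x {} = 0\<close> in the library, whereas here the distance to the empty set is infinite.\<close>

definition ext_dist :: "'a::metric_space \<Rightarrow> 'a set \<Rightarrow> ereal" where
  "ext_dist x Y = (if Y = {} then \<infinity> else ereal (infdist x Y))"

definition sector :: "real^'n::finite \<Rightarrow> real \<Rightarrow> real \<Rightarrow> (real^'n) set" where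
  "sector \<omega> \<delta> r = {x. 0 < norm x \<and> norm x < r \<and> norm (x /\<^sub>R norm x - \<omega>) < \<delta>}"

definition annulus :: "real \<Rightarrow> real \<Rightarrow> (real^'n::finite) set" where
  "annulus K \<rho> = {x. \<rho> / K < norm x \<and> norm x < K * \<rho>}"

definition forbidden :: "nat \<Rightarrow> (real^'n::finite \<Rightarrow> real) set \<Rightarrow> real^'n \<Rightarrow> bool" where
  "forbidden m I \<omega> \<longleftrightarrow>
     (\<exists>(L::nat) p c \<delta> r. (\<forall>l\<in>{1..L}. p l \<in> I) \<and> c > 0 \<and> \<delta> > 0 \<and> r > 0 \<and>
        (\<forall>x\<in>sector \<omega> \<delta> r. (\<Sum>l=1..L. \<bar>p l x\<bar>) > c * norm x ^ m))"

definition Allow :: "nat \<Rightarrow> (real^'n::finite \<Rightarrow> real) set \<Rightarrow> (real^'n) set" where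
  "Allow m I = {\<omega> \<in> sphere 0 1. \<not> forbidden m I \<omega>}"

definition implies_jet ::
  "nat \<Rightarrow> (real^'n::finite \<Rightarrow> real) set \<Rightarrow> (real^'n \<Rightarrow> real) \<Rightarrow> bool" where
  "implies_jet m I p \<longleftrightarrow>
     (\<exists>A>0. \<exists>(L::nat) Q. (\<forall>l\<in>{1..L}. Q l \<in> I) \<and>
       (\<forall>\<epsilon>>0. \<exists>\<delta>>0. \<exists>r>0. \<forall>\<rho>. 0 < \<rho> \<and> \<rho> \<le> r \<longrightarrow>
         (\<exists>F S. Cm_on m (annulus 4 \<rho>) F \<and>
            (\<forall>l\<in>{1..L}. Cm_on m (annulus 4 \<rho>) (S l)) \<and>
            (\<forall>x\<in>annulus 4 \<rho>. \<forall>\<alpha>\<in>multi_indices m.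
               \<bar>multi_deriv \<alpha> F x\<bar> \<le> \<epsilon> * \<rho> ^ (m - (\<Sum>i\<in>UNIV. \<alpha> i))) \<and>
            (\<forall>l\<in>{1..L}. \<forall>x\<in>annulus 4 \<rho>. \<forall>\<alpha>\<in>multi_indices m.
               \<bar>multi_deriv \<alpha> (S l) x\<bar> \<le> A / \<rho> ^ (\<Sum>i\<in>UNIV. \<alpha> i)) \<and>
            (\<forall>x\<in>annulus 2 \<rho>. ext_dist (x /\<^sub>R norm x) (Allow m I) < ereal \<delta> \<longrightarrow>
               p x = F x + (\<Sum>l=1..L. S l x * Q l x)))))"

definition jet_closure :: "nat \<Rightarrow> (real^'n::finite \<Rightarrow> real) set \<Rightarrow> (real^'n \<Rightarrow> real) set" where
  "jet_closure m I = {p \<in> polys0 m. implies_jet m I p}"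

end

theory Submission
  imports Defs
begin

text \<open>
  Suppose \<open>p\<close> is implied by the jets \<open>Q l\<close> of functions \<open>f l\<close> vanishing on \<open>E\<close>. On \<open>E\<close> the
  polynomial \<open>Q l\<close> agrees with \<open>g l = Q l - f l\<close>, whose derivatives of order \<open>k\<close> are
  \<open>o(|x|^(m - k))\<close> at the origin. By compactness of the sphere, the directions of points of \<open>E\<close>
  tending to the origin accumulate only at allowed directions, so in each small annulus of radius
  \<open>\<rho>\<close> the function \<open>H = F + (\<Sum>l. S l * g l)\<close> agrees with \<open>p\<close> on \<open>E\<close> and has derivatives of order
  \<open>o(\<rho>^(m - k))\<close>. Gluing these functions with a dyadic partition of unity gives a function \<open>G\<close>
  of class C^m with vanishing jet, equal to \<open>p\<close> on \<open>E\<close> near the origin; then \<open>p\<close> is the jet of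
  \<open>p - G\<close>, cut off away from the origin.
\<close>

section \<open>Functions of class C^m\<close>

text \<open>Two obstacles shape the gluing. The data \<open>F\<close> and \<open>S\<close> are given
  only after \<epsilon>, so each scale has a whole family of candidates \<open>H\<close>, whereas
  the glued function needs one for all \<epsilon>; a nearly optimal candidate is selected at each
  scale. Moreover, the candidates of neighbouring scales agree on \<open>E\<close> but need not
  agree elsewhere. This is harmless, because a partition of unity reproduces any value that the
  pieces have in common at a point. The dyadic sum is infinite at every neighbourhood of the origin,
  so its regularity there is not obtained term by term: estimates off the origin together with the
  value 0 at the origin already force class C^m and a zero jet. Iterated derivatives are indexed by
  lists, on which induction is possible, since \<open>multi_deriv\<close> hides an arbitrary choice
  of list. The head of a list is the outermost derivative and its last entry acts first. Symmetry of
  mixed derivatives serves to pass between the two descriptions. Cutoffs only have to be of class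
  C^m, so truncated powers of polynomials suffice.\<close>

abbreviation pderivs :: "'n::finite list \<Rightarrow> (real^'n \<Rightarrow> real) \<Rightarrow> real^'n \<Rightarrow> real" where
  "pderivs is f \<equiv> foldr partial_deriv is f"

section \<open>Partial derivatives and their locality\<close>

lemma eventually_line:
  fixes x :: "real^'n::finite"
  assumes "open U" "x \<in> U"
  shows "\<forall>\<^sub>F t in nhds (0::real). x + t *\<^sub>R a \<in> U"
proof -
  have "((\<lambda>t::real. x + t *\<^sub>R a) \<longlongrightarrow> x + 0 *\<^sub>R a) (nhds 0)"
    by (intro tendsto_intros) (simp add: filterlim_ident)
  then show ?thesis
    using assms topological_tendstoD by fastforce
qed

lemma partial_deriv_eqI:
  assumes "((\<lambda>t. f (x + t *\<^sub>R axis i 1)) has_real_derivative D) (at 0)"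
  shows "partial_deriv i f x = D"
  unfolding partial_deriv_def by (rule DERIV_imp_deriv[OF assms])

lemma has_partial_deriv_cong:
  fixes f g :: "real^'n::finite \<Rightarrow> real"
  assumes "open U" "x \<in> U" "\<And>y. y \<in> U \<Longrightarrow> f y = g y"
  shows "((\<lambda>t. f (x + t *\<^sub>R axis i 1)) has_real_derivative D) (at 0) \<longleftrightarrow>
    ((\<lambda>t. g (x + t *\<^sub>R axis i 1)) has_real_derivative D) (at 0)"
proof (rule DERIV_cong_ev)
  show "\<forall>\<^sub>F t in nhds (0::real). f (x + t *\<^sub>R axis i 1) = g (x + t *\<^sub>R axis i 1)"
    using eventually_line[OF assms(1,2), of "axis i 1"]
    by eventually_elim (use assms(3) in auto)
qed auto

text \<open>No differentiability is assumed: \<open>deriv\<close> chooses among the numbers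
  satisfying the derivative predicate, and near \<open>x\<close> both functions satisfy it for the
  same numbers.\<close>

lemma partial_deriv_cong:
  fixes f g :: "real^'n::finite \<Rightarrow> real"
  assumes "open U" "x \<in> U" "\<And>y. y \<in> U \<Longrightarrow> f y = g y"
  shows "partial_deriv i f x = partial_deriv i g x"
  unfolding partial_deriv_def deriv_def using has_partial_deriv_cong[of U x f g, OF assms] by simp

lemma pderivs_cong:
  assumes "open U" "x \<in> U" "\<And>y. y \<in> U \<Longrightarrow> f y = g y"
  shows "pderivs is f x = pderivs is g x"
  using assms(2)
proof (induction "is" arbitrary: x)
  case (Cons i "is")
  have "partial_deriv i (pderivs is f) x = partial_deriv i (pderivs is g) x"
    by (rule partial_deriv_cong[OF assms(1) Cons.prems Cons.IH])
  then show ?case by simp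
qed (use assms in auto)

lemma Cm_on_has_partial_deriv:
  assumes "Cm_on (Suc m) U f" "x \<in> U"
  shows "((\<lambda>t. f (x + t *\<^sub>R axis i 1)) has_real_derivative partial_deriv i f x) (at 0)"
  unfolding partial_deriv_def
  using assms by (simp add: DERIV_deriv_iff_field_differentiable)

lemma Cm_on_has_derivative_line:
  assumes "Cm_on (Suc m) U f" "x + a *\<^sub>R axis i 1 \<in> U"
  shows "((\<lambda>t. f (x + t *\<^sub>R axis i 1)) has_real_derivative partial_deriv i f (x + a *\<^sub>R axis i 1)) (at a)"
  using Cm_on_has_partial_deriv[OF assms, of i] DERIV_shift[of "\<lambda>t. f (x + t *\<^sub>R axis i 1)" _ 0 a]
  by (simp add: algebra_simps)

lemma Cm_on_imp_continuous: "Cm_on m U f \<Longrightarrow> continuous_on U f"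
  by (cases m) auto

lemma Cm_on_Suc_partial: "Cm_on (Suc m) U f \<Longrightarrow> Cm_on m U (partial_deriv i f)"
  by simp

lemma Cm_on_Suc_D: "Cm_on (Suc m) U f \<Longrightarrow> Cm_on m U f"
proof (induction m arbitrary: f)
  case (Suc m)
  show ?case using Suc.IH[of "partial_deriv _ f"] Suc.prems by (subst Cm_on.simps) auto
qed simp

lemma Cm_on_le:
  assumes "Cm_on m U f" "k \<le> m"
  shows "Cm_on k U f"
  using assms(2,1) by (induction rule: inc_induct) (auto dest: Cm_on_Suc_D simp del: Cm_on.simps)

lemma Cm_on_subset: "Cm_on m U f \<Longrightarrow> V \<subseteq> U \<Longrightarrow> Cm_on m V f"
  by (induction m arbitrary: f) (auto intro: continuous_on_subset)

lemma Cm_on_cong: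
  assumes "open U" "\<And>y. y \<in> U \<Longrightarrow> f y = g y"
  shows "Cm_on m U f \<longleftrightarrow> Cm_on m U g"
  using assms(2)
proof (induction m arbitrary: f g)
  case 0
  then show ?case by (simp cong: continuous_on_cong)
next
  case (Suc m)
  have c: "continuous_on U f = continuous_on U g"
    using Suc.prems by (simp cong: continuous_on_cong)
  have d: "(\<lambda>t. f (x + t *\<^sub>R axis i 1)) field_differentiable (at 0) \<longleftrightarrow>
      (\<lambda>t. g (x + t *\<^sub>R axis i 1)) field_differentiable (at 0)" if "x \<in> U" for x i
    unfolding field_differentiable_def
    using has_partial_deriv_cong[of U x f g, OF assms(1) that Suc.prems] by simp
  have p: "Cm_on m U (partial_deriv i f) = Cm_on m U (partial_deriv i g)" for i
    by (rule Suc.IH) (rule partial_deriv_cong[OF assms(1) _ Suc.prems])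
  show ?case using c d p by simp
qed

text \<open>The candidate \<open>g i\<close> has to be correct only on \<open>U\<close>. Off
  \<open>U\<close> it may differ from \<open>partial_deriv i f\<close>, whose values there are
  arbitrary; openness of \<open>U\<close> lets one be exchanged for the other.\<close>

lemma Cm_on_SucI:
  assumes "open U" "continuous_on U f"
    and "\<And>i x. x \<in> U \<Longrightarrow> ((\<lambda>t. f (x + t *\<^sub>R axis i 1)) has_real_derivative g i x) (at 0)"
    and "\<And>i. Cm_on m U (g i)"
  shows "Cm_on (Suc m) U f"
proof -
  have "Cm_on m U (partial_deriv i f)" for i
    using Cm_on_cong[OF assms(1), of "partial_deriv i f" "g i" m] partial_deriv_eqI assms(3,4)
    by blast
  then show ?thesis using assms(2,3) by (auto simp: field_differentiable_def)
qed

text \<open>Needed for functions given by different formulas near different points, such as the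
  pieces of the dyadic sum and the sum itself.\<close>

lemma Cm_on_local:
  assumes "\<And>x. x \<in> U \<Longrightarrow> \<exists>V. open V \<and> x \<in> V \<and> Cm_on m V f"
  shows "Cm_on m U f"
  using assms
proof (induction m arbitrary: f)
  case 0
  then show ?case
    using continuous_on_eq_continuous_at continuous_at_imp_continuous_on by (metis Cm_on.simps(1))
next
  case (Suc m)
  have c: "continuous_on U f"
    using Suc.prems continuous_on_eq_continuous_at continuous_at_imp_continuous_on
    by (metis Cm_on.simps(2))
  have "Cm_on m U (partial_deriv i f)" for i
  proof (rule Suc.IH)
    show "\<exists>V. open V \<and> x \<in> V \<and> Cm_on m V (partial_deriv i f)" if "x \<in> U" for x
      using Suc.prems[OF that] by auto
  qed
  then show ?case using c Suc.prems by fastforce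
qed

section \<open>Algebra of C^m functions\<close>

lemma Cm_on_const [simp, intro]: "Cm_on m (U :: (real^'n::finite) set) (\<lambda>x. c)"
proof (induction m arbitrary: c)
  case (Suc m)
  have "partial_deriv i (\<lambda>x. c) = (\<lambda>x. 0)" for i :: 'n
    by (intro ext partial_deriv_eqI) simp
  then show ?case using Suc by simp
qed simp

lemma partial_deriv_add:
  assumes "Cm_on (Suc m) U f" "Cm_on (Suc m) U g" "x \<in> U"
  shows "partial_deriv i (\<lambda>x. f x + g x) x = partial_deriv i f x + partial_deriv i g x"
  by (intro partial_deriv_eqI DERIV_add Cm_on_has_partial_deriv[OF assms(1,3)]
      Cm_on_has_partial_deriv[OF assms(2,3)])

lemma Cm_on_add:
  assumes "open U" "Cm_on m U f" "Cm_on m U g"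
  shows "Cm_on m U (\<lambda>x. f x + g x)"
  using assms(2,3)
proof (induction m arbitrary: f g)
  case (Suc m)
  show ?case
  proof (rule Cm_on_SucI[where g = "\<lambda>i x. partial_deriv i f x + partial_deriv i g x"])
    show "continuous_on U (\<lambda>x. f x + g x)"
      using Suc.prems by (intro continuous_intros) (auto dest: Cm_on_imp_continuous)
    show "Cm_on m U (\<lambda>x. partial_deriv i f x + partial_deriv i g x)" for i
      using Suc by simp
  qed (use assms(1) Suc.prems in \<open>auto intro!: DERIV_add Cm_on_has_partial_deriv simp del: Cm_on.simps\<close>)
qed (auto intro: continuous_intros)

lemma has_partial_deriv_mult:
  assumes "Cm_on (Suc m) U f" "Cm_on (Suc m) U g" "x \<in> U"
  shows "((\<lambda>t. f (x + t *\<^sub>R axis i 1) * g (x + t *\<^sub>R axis i 1)) has_real_derivative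
    partial_deriv i f x * g x + f x * partial_deriv i g x) (at 0)"
  using DERIV_mult[OF Cm_on_has_partial_deriv[OF assms(1,3)] Cm_on_has_partial_deriv[OF assms(2,3)]]
  by (simp add: algebra_simps)

lemma Cm_on_mult:
  assumes "open U" "Cm_on m U f" "Cm_on m U g"
  shows "Cm_on m U (\<lambda>x. f x * g x)"
  using assms(2,3)
proof (induction m arbitrary: f g)
  case (Suc m)
  show ?case
  proof (rule Cm_on_SucI[where g = "\<lambda>i x. partial_deriv i f x * g x + f x * partial_deriv i g x"])
    show "continuous_on U (\<lambda>x. f x * g x)"
      using Suc.prems by (intro continuous_intros) (auto dest: Cm_on_imp_continuous)
    show "Cm_on m U (\<lambda>x. partial_deriv i f x * g x + f x * partial_deriv i g x)" for i
      by (intro Cm_on_add[OF assms(1)] Suc.IH Cm_on_Suc_partial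
          Cm_on_Suc_D[OF Suc.prems(1)] Cm_on_Suc_D[OF Suc.prems(2)] Suc.prems)
  qed (rule assms(1), rule has_partial_deriv_mult[OF Suc.prems])
qed (auto intro: continuous_intros)

lemma Cm_on_cmult: "open U \<Longrightarrow> Cm_on m U f \<Longrightarrow> Cm_on m U (\<lambda>x. c * f x)"
  by (rule Cm_on_mult) auto

lemma Cm_on_diff:
  assumes "open U" "Cm_on m U f" "Cm_on m U g"
  shows "Cm_on m U (\<lambda>x. f x - g x)"
  using Cm_on_add[OF assms(1,2) Cm_on_cmult[OF assms(1,3), of "-1"]] by simp

lemma Cm_on_sum:
  assumes "open U" "\<And>a. a \<in> A \<Longrightarrow> Cm_on m U (f a)"
  shows "Cm_on m U (\<lambda>x. \<Sum>a\<in>A. f a x)"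
  using assms(2)
proof (induction A rule: infinite_finite_induct)
  case (insert a A)
  then show ?case by (simp add: Cm_on_add[OF assms(1)])
qed auto

lemma Cm_on_prod:
  assumes "open U" "\<And>a. a \<in> A \<Longrightarrow> Cm_on m U (f a)"
  shows "Cm_on m U (\<lambda>x. \<Prod>a\<in>A. f a x)"
  using assms(2)
proof (induction A rule: infinite_finite_induct)
  case (insert a A)
  then show ?case by (simp add: Cm_on_mult[OF assms(1)])
qed auto

lemma Cm_on_power: "open U \<Longrightarrow> Cm_on m U f \<Longrightarrow> Cm_on m U (\<lambda>x. f x ^ k)"
  by (induction k) (simp_all add: Cm_on_mult)

lemma Cm_on_nth: "open U \<Longrightarrow> Cm_on m U (\<lambda>x. x $ i)"
proof (induction m)
  case 0
  then show ?case by (auto intro: continuous_intros)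
next
  case (Suc m)
  show ?case
  proof (rule Cm_on_SucI[where g = "\<lambda>j x. axis j 1 $ i"])
    show "((\<lambda>t. (x + t *\<^sub>R axis j 1) $ i) has_real_derivative axis j 1 $ i) (at 0)" for j x
      by (auto intro!: derivative_eq_intros)
  qed (use Suc in \<open>auto intro: continuous_intros\<close>)
qed

lemma Cm_on_norm_square: "open U \<Longrightarrow> Cm_on m U (\<lambda>x. (norm x)\<^sup>2)"
  unfolding power2_norm_eq_inner inner_vec_def inner_real_def
  by (intro Cm_on_sum Cm_on_mult Cm_on_nth)

lemma Cm_on_inverse:
  assumes "open U" "Cm_on m U f" "\<And>x. x \<in> U \<Longrightarrow> f x \<noteq> 0"
  shows "Cm_on m U (\<lambda>x. inverse (f x))"
  using assms(2)
proof (induction m)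
  case 0
  then show ?case using assms(3) by (auto intro!: continuous_intros)
next
  case (Suc m)
  \<comment> \<open>The derivative of \<open>1/f\<close> is \<open>-f'/f^2\<close>, which contains
    \<open>1/f\<close> again, one class lower; so the induction keeps \<open>f\<close>
    fixed.\<close>
  have IH: "Cm_on m U (\<lambda>x. inverse (f x))" by (rule Suc.IH[OF Cm_on_Suc_D[OF Suc.prems]])
  show ?case
  proof (rule Cm_on_SucI[where g = "\<lambda>i x. (-1) * ((inverse (f x) * partial_deriv i f x) * inverse (f x))"])
    show "continuous_on U (\<lambda>x. inverse (f x))"
      using IH by (rule Cm_on_imp_continuous)
    show "((\<lambda>t. inverse (f (x + t *\<^sub>R axis i 1))) has_real_derivative
       (-1) * ((inverse (f x) * partial_deriv i f x) * inverse (f x))) (at 0)" if "x \<in> U" for i x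
      using DERIV_inverse'[OF Cm_on_has_partial_deriv[OF Suc.prems that]] assms(3)[OF that] by simp
    show "Cm_on m U (\<lambda>x. (-1) * ((inverse (f x) * partial_deriv i f x) * inverse (f x)))" for i
      by (intro Cm_on_cmult Cm_on_mult assms(1) IH Cm_on_Suc_partial Suc.prems)
  qed (rule assms(1))
qed

section \<open>Truncated powers and dilations\<close>

lemma DERIV_max0_power:
  "((\<lambda>t::real. max 0 t ^ Suc (Suc k)) has_real_derivative real (Suc (Suc k)) * max 0 t ^ Suc k) (at t)"
proof (cases "t = 0")
  case True
  have "((\<lambda>t::real. max 0 t ^ Suc (Suc k)) has_real_derivative 0) (at 0)"
    unfolding has_field_derivative_def has_derivative_at
  proof (intro conjI)
    \<comment> \<open>At \<open>h = 0\<close> division by zero returns 0, which is also the value on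
      the right.\<close>
    have e: "norm (max 0 (0 + h) ^ Suc (Suc k) - max 0 0 ^ Suc (Suc k) - 0 * h) / norm h = max 0 h ^ Suc k" for h :: real
      by (cases "h = 0") (auto simp: max_def power_abs)
    have "((\<lambda>h::real. max 0 h ^ Suc k) \<longlongrightarrow> max 0 0 ^ Suc k) (at 0)"
      by (intro tendsto_intros)
    then show "(\<lambda>h::real. norm (max 0 (0 + h) ^ Suc (Suc k) - max 0 0 ^ Suc (Suc k) - 0 * h) / norm h) \<midarrow>0\<rightarrow> 0"
      unfolding e by simp
  qed (rule bounded_linear_mult_right)
  then show ?thesis using True by simp
next
  case False
  then consider "t > 0" | "t < 0" by linarith
  then show ?thesis
  proof cases
    case 1
    have "((\<lambda>t::real. t ^ Suc (Suc k)) has_real_derivative real (Suc (Suc k)) * t ^ Suc k) (at t)"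
      using DERIV_pow[of "Suc (Suc k)" t UNIV] by simp
    then have "((\<lambda>t::real. max 0 t ^ Suc (Suc k)) has_real_derivative real (Suc (Suc k)) * t ^ Suc k) (at t)"
      by (rule has_field_derivative_transform_within_open[where S = "{0<..}"]) (use 1 in auto)
    then show ?thesis using 1 by (simp add: max_def)
  next
    case 2
    have "((\<lambda>t::real. 0) has_real_derivative 0) (at t)" by simp
    then have "((\<lambda>t::real. max 0 t ^ Suc (Suc k)) has_real_derivative 0) (at t)"
      by (rule has_field_derivative_transform_within_open[where S = "{..<0}"]) (use 2 in auto)
    then show ?thesis using 2 by simp
  qed
qed

text \<open>Each differentiation costs one power; starting from exponent m + 1, after m of them
  exponent 1 is left, which is still continuous.\<close>

lemma Cm_on_max0_power:
  assumes "open U" "Cm_on m U f"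
  shows "Cm_on m U (\<lambda>x. max 0 (f x) ^ Suc m)"
  using assms(2)
proof (induction m)
  case 0
  then show ?case by (auto intro!: continuous_intros)
next
  case (Suc m)
  show ?case
  proof (rule Cm_on_SucI[where g = "\<lambda>i x. real (Suc (Suc m)) * (max 0 (f x) ^ Suc m * partial_deriv i f x)"])
    show "continuous_on U (\<lambda>x. max 0 (f x) ^ Suc (Suc m))"
      using Cm_on_imp_continuous[OF Suc.prems] by (intro continuous_intros)
    show "((\<lambda>t. max 0 (f (x + t *\<^sub>R axis i 1)) ^ Suc (Suc m)) has_real_derivative
       real (Suc (Suc m)) * (max 0 (f x) ^ Suc m * partial_deriv i f x)) (at 0)" if "x \<in> U" for i x
      using DERIV_chain[OF DERIV_max0_power Cm_on_has_partial_deriv[OF Suc.prems that]]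
      by (simp add: o_def mult.assoc)
    show "Cm_on m U (\<lambda>x. real (Suc (Suc m)) * (max 0 (f x) ^ Suc m * partial_deriv i f x))" for i
      by (intro Cm_on_cmult Cm_on_mult assms(1) Suc.IH Cm_on_Suc_partial Cm_on_Suc_D[OF Suc.prems] Suc.prems)
  qed (rule assms(1))
qed

lemma has_partial_deriv_scale:
  assumes "Cm_on (Suc m) UNIV f"
  shows "((\<lambda>t. f (c *\<^sub>R (x + t *\<^sub>R axis i 1))) has_real_derivative c * partial_deriv i f (c *\<^sub>R x)) (at 0)"
proof -
  have "((\<lambda>t. f (c *\<^sub>R x + t *\<^sub>R axis i 1)) has_real_derivative partial_deriv i f (c *\<^sub>R x)) (at (c * 0))"
    using Cm_on_has_partial_deriv[OF assms, of "c *\<^sub>R x" i] by simp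
  then have "((\<lambda>t. f (c *\<^sub>R x + (c * t) *\<^sub>R axis i 1)) has_real_derivative partial_deriv i f (c *\<^sub>R x) * c) (at 0)"
    by (rule DERIV_chain2) (auto intro!: derivative_eq_intros)
  then show ?thesis by (simp add: algebra_simps)
qed

lemma Cm_on_scale:
  assumes "Cm_on m UNIV f"
  shows "Cm_on m UNIV (\<lambda>x. f (c *\<^sub>R x))"
  using assms
proof (induction m arbitrary: f)
  case 0
  then show ?case by (auto intro!: continuous_on_compose2[of UNIV f] continuous_intros)
next
  case (Suc m)
  show ?case
  proof (rule Cm_on_SucI[where g = "\<lambda>i x. c * partial_deriv i f (c *\<^sub>R x)"])
    show "continuous_on UNIV (\<lambda>x. f (c *\<^sub>R x))"
      using Cm_on_imp_continuous[OF Suc.prems]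
      by (auto intro!: continuous_on_compose2[of UNIV f] continuous_intros)
    show "Cm_on m UNIV (\<lambda>x. c * partial_deriv i f (c *\<^sub>R x))" for i
      by (intro Cm_on_cmult Suc.IH[of "partial_deriv i f"] Cm_on_Suc_partial Suc.prems open_UNIV)
  qed (use has_partial_deriv_scale[OF Suc.prems] in auto)
qed

lemma Cm_on_pderivs:
  assumes "Cm_on (length is + k) U f"
  shows "Cm_on k U (pderivs is f)"
  using assms
\<comment> \<open>The last entry acts on \<open>f\<close> directly, so reverse induction replaces
  \<open>f\<close> by one of its partial derivatives, one class lower.\<close>
proof (induction "is" arbitrary: f rule: rev_induct)
  case (snoc i "is")
  then show ?case by simp
qed simp

lemma pderivs_scale:
  assumes "Cm_on m UNIV f" "length is \<le> m"
  shows "pderivs is (\<lambda>x. f (c *\<^sub>R x)) x = c ^ length is * pderivs is f (c *\<^sub>R x)"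
  using assms(2)
proof (induction "is" arbitrary: x)
  case (Cons i "is")
  have C: "Cm_on (Suc 0) UNIV (pderivs is f)"
    using Cons.prems by (intro Cm_on_pderivs Cm_on_le[OF assms(1)]) auto
  have e: "pderivs is (\<lambda>x. f (c *\<^sub>R x)) = (\<lambda>x. c ^ length is * pderivs is f (c *\<^sub>R x))"
    using Cons by auto
  show ?case
    using DERIV_cmult[OF has_partial_deriv_scale[OF C], of "c ^ length is" c x i]
    by (simp add: e partial_deriv_eqI mult_ac)
qed simp

section \<open>Order of differentiation and jets\<close>

lemma mean_value_square:
  fixes f :: "real^'n::finite \<Rightarrow> real"
  assumes "Cm_on 2 U f" and s: "s > 0"
    and U: "\<And>a b. 0 \<le> a \<Longrightarrow> a \<le> s \<Longrightarrow> 0 \<le> b \<Longrightarrow> b \<le> s \<Longrightarrow> x + a *\<^sub>R axis i 1 + b *\<^sub>R axis j 1 \<in> U"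
  shows "\<exists>a b. 0 < a \<and> a < s \<and> 0 < b \<and> b < s \<and>
    f (x + s *\<^sub>R axis i 1 + s *\<^sub>R axis j 1) - f (x + s *\<^sub>R axis i 1) - f (x + s *\<^sub>R axis j 1) + f x =
    s\<^sup>2 * partial_deriv j (partial_deriv i f) (x + a *\<^sub>R axis i 1 + b *\<^sub>R axis j 1)"
proof -
  have C2: "Cm_on (Suc (Suc 0)) U f" using assms(1) by (simp add: numeral_2_eq_2)
  have C1: "Cm_on (Suc 0) U (partial_deriv i f)" using C2 by (rule Cm_on_Suc_partial)
  \<comment> \<open>The second difference over the square is \<open>u s - u 0\<close>, where
    \<open>u\<close> is the increment of \<open>f\<close> in direction \<open>j\<close>. One mean
    value theorem in direction \<open>i\<close> turns it into an increment of
    \<open>partial_deriv i f\<close>, a second one in direction \<open>j\<close> into a mixed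
    derivative.\<close>
  define u where "u a = f (x + a *\<^sub>R axis i 1 + s *\<^sub>R axis j 1) - f (x + a *\<^sub>R axis i 1)" for a
  define u' where "u' a = partial_deriv i f (x + a *\<^sub>R axis i 1 + s *\<^sub>R axis j 1)
      - partial_deriv i f (x + a *\<^sub>R axis i 1)" for a
  have u: "(u has_real_derivative u' a) (at a)" if "0 \<le> a" "a \<le> s" for a
  proof -
    have "((\<lambda>a. f ((x + s *\<^sub>R axis j 1) + a *\<^sub>R axis i 1)) has_real_derivative
        partial_deriv i f ((x + s *\<^sub>R axis j 1) + a *\<^sub>R axis i 1)) (at a)"
      using U[of a s] that s by (intro Cm_on_has_derivative_line[OF C2]) (simp add: algebra_simps)
    moreover have "((\<lambda>a. f (x + a *\<^sub>R axis i 1)) has_real_derivative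
        partial_deriv i f (x + a *\<^sub>R axis i 1)) (at a)"
      using U[of a 0] that s by (intro Cm_on_has_derivative_line[OF C2]) simp
    ultimately show ?thesis
      unfolding u_def u'_def by (auto intro!: DERIV_diff simp: add_ac)
  qed
  obtain a where a: "0 < a" "a < s" "u s - u 0 = s * u' a"
    using MVT2[OF s u] by auto
  obtain b where b: "0 < b" "b < s"
    "partial_deriv i f (x + a *\<^sub>R axis i 1 + s *\<^sub>R axis j 1) - partial_deriv i f (x + a *\<^sub>R axis i 1 + 0 *\<^sub>R axis j 1)
      = (s - 0) * partial_deriv j (partial_deriv i f) (x + a *\<^sub>R axis i 1 + b *\<^sub>R axis j 1)"
    using MVT2[OF s, of "\<lambda>b. partial_deriv i f (x + a *\<^sub>R axis i 1 + b *\<^sub>R axis j 1)"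
        "\<lambda>b. partial_deriv j (partial_deriv i f) (x + a *\<^sub>R axis i 1 + b *\<^sub>R axis j 1)"]
      Cm_on_has_derivative_line[OF C1] U a by force
  then have "u' a = s * partial_deriv j (partial_deriv i f) (x + a *\<^sub>R axis i 1 + b *\<^sub>R axis j 1)"
    by (simp add: u'_def)
  then have "u s - u 0 = s\<^sup>2 * partial_deriv j (partial_deriv i f) (x + a *\<^sub>R axis i 1 + b *\<^sub>R axis j 1)"
    using a(3) by (simp add: power2_eq_square)
  then show ?thesis
    using a(1,2) b(1,2) by (intro exI[of _ a] exI[of _ b]) (auto simp: u_def)
qed

text \<open>The second difference over a square is symmetric in \<open>i\<close> and
  \<open>j\<close>, so both mixed derivatives take the same value somewhere in every small square;
  continuity carries this to the corner.\<close>

lemma partial_deriv_commute: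
  fixes f :: "real^'n::finite \<Rightarrow> real"
  assumes "open U" "Cm_on 2 U f" "x \<in> U"
  shows "partial_deriv i (partial_deriv j f) x = partial_deriv j (partial_deriv i f) x"
proof -
  have C2: "Cm_on (Suc (Suc 0)) U f" using assms(2) by (simp add: numeral_2_eq_2)
  have cont: "isCont (partial_deriv i (partial_deriv j f)) x" for i j
    using C2 assms(1,3) by (simp add: continuous_on_eq_continuous_at)
  have "\<bar>partial_deriv i (partial_deriv j f) x - partial_deriv j (partial_deriv i f) x\<bar> < e"
    if "e > 0" for e
  proof -
    let ?P = "partial_deriv i (partial_deriv j f)" and ?Q = "partial_deriv j (partial_deriv i f)"
    obtain d1 where d1: "d1 > 0" "\<And>y. dist y x < d1 \<Longrightarrow> dist (?P y) (?P x) < e / 2"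
      using cont[of i j] \<open>e > 0\<close> unfolding continuous_at_eps_delta by (meson half_gt_zero)
    obtain d2 where d2: "d2 > 0" "\<And>y. dist y x < d2 \<Longrightarrow> dist (?Q y) (?Q x) < e / 2"
      using cont[of j i] \<open>e > 0\<close> unfolding continuous_at_eps_delta by (meson half_gt_zero)
    obtain d3 where d3: "d3 > 0" "ball x d3 \<subseteq> U"
      using assms(1,3) open_contains_ball by blast
    \<comment> \<open>All points of the square lie within \<open>2 * s < d\<close> of
      \<open>x\<close>, hence in \<open>U\<close> and in both continuity balls.\<close>
    define d s where "d = min d1 (min d2 d3)" and "s = d / 4"
    have ds: "d > 0" "s > 0" "2 * s < d" "d \<le> d1" "d \<le> d2" "d \<le> d3"
      using d1(1) d2(1) d3(1) by (auto simp: d_def s_def)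
    have near: "dist (x + a *\<^sub>R axis k 1 + b *\<^sub>R axis l 1) x < d"
      if "0 \<le> a" "a \<le> s" "0 \<le> b" "b \<le> s" for a b and k l :: 'n
    proof -
      have "norm (a *\<^sub>R axis k (1::real) + b *\<^sub>R axis l 1) \<le> a + b"
        using that by (intro norm_triangle_le) (simp add: norm_axis_1)
      then show ?thesis
        using that ds by (simp add: dist_norm add.assoc)
    qed
    have inU: "x + a *\<^sub>R axis k 1 + b *\<^sub>R axis l 1 \<in> U"
      if "0 \<le> a" "a \<le> s" "0 \<le> b" "b \<le> s" for a b k l
      using near[OF that, of k l] d3(2) ds by (auto simp: dist_commute mem_ball subset_iff)
    obtain a b where 1: "0 < a" "a < s" "0 < b" "b < s"
      "f (x + s *\<^sub>R axis i 1 + s *\<^sub>R axis j 1) - f (x + s *\<^sub>R axis i 1) - f (x + s *\<^sub>R axis j 1) + f x =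
        s\<^sup>2 * ?Q (x + a *\<^sub>R axis i 1 + b *\<^sub>R axis j 1)"
      using mean_value_square[OF assms(2) ds(2) inU] by blast
    obtain a' b' where 2: "0 < a'" "a' < s" "0 < b'" "b' < s"
      "f (x + s *\<^sub>R axis j 1 + s *\<^sub>R axis i 1) - f (x + s *\<^sub>R axis j 1) - f (x + s *\<^sub>R axis i 1) + f x =
        s\<^sup>2 * ?P (x + a' *\<^sub>R axis j 1 + b' *\<^sub>R axis i 1)"
      using mean_value_square[OF assms(2) ds(2) inU] by blast
    have "s\<^sup>2 * ?Q (x + a *\<^sub>R axis i 1 + b *\<^sub>R axis j 1) = s\<^sup>2 * ?P (x + a' *\<^sub>R axis j 1 + b' *\<^sub>R axis i 1)"
      unfolding 1(5)[symmetric] 2(5)[symmetric] by (simp add: add_ac)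
    then have eq: "?Q (x + a *\<^sub>R axis i 1 + b *\<^sub>R axis j 1) = ?P (x + a' *\<^sub>R axis j 1 + b' *\<^sub>R axis i 1)"
      using ds(2) by simp
    have "dist (?Q (x + a *\<^sub>R axis i 1 + b *\<^sub>R axis j 1)) (?Q x) < e / 2"
      using near[of a b i j] 1 ds by (intro d2(2)) auto
    moreover have "dist (?P (x + a' *\<^sub>R axis j 1 + b' *\<^sub>R axis i 1)) (?P x) < e / 2"
      using near[of a' b' j i] 2 ds by (intro d1(2)) auto
    ultimately show ?thesis
      unfolding eq dist_real_def by linarith
  qed
  then show ?thesis
    by (metis abs_ge_zero eq_iff_diff_eq_0 abs_eq_0 less_irrefl order_less_le)
qed

lemma pderivs_rotate1:
  fixes f :: "real^'n::finite \<Rightarrow> real"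
  assumes "open U" "Cm_on m U f" "length is < m" "x \<in> U"
  shows "pderivs (i # is) f x = pderivs (is @ [i]) f x"
  using assms(3,4)
proof (induction "is" arbitrary: x)
  case (Cons j "is")
  have "Cm_on 2 U (pderivs is f)"
    using Cons.prems by (intro Cm_on_pderivs Cm_on_le[OF assms(2)]) simp
  from partial_deriv_commute[OF assms(1) this Cons.prems(2), of i j]
  have "pderivs (i # j # is) f x = partial_deriv j (pderivs (i # is) f) x"
    by simp
  also have "\<dots> = partial_deriv j (pderivs (is @ [i]) f) x"
    using Cons by (intro partial_deriv_cong[OF assms(1)]) auto
  finally show ?case by simp
qed simp

text \<open>Rotation alone suffices: an occurrence of \<open>i\<close> inside \<open>js\<close> is
  first sent to the innermost place past the entries after it, and from there to the outermost place
  past all others, where it meets the head of \<open>is\<close>.\<close>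

lemma pderivs_permute:
  fixes f :: "real^'n::finite \<Rightarrow> real"
  assumes "open U" "Cm_on m U f" "length is \<le> m" "x \<in> U" "mset is = mset js"
  shows "pderivs is f x = pderivs js f x"
  using assms(3-5)
proof (induction "is" arbitrary: js x)
  case (Cons i "is")
  have "i \<in> set js" using Cons.prems(3) by (metis list.set_intros(1) set_mset_mset)
  then obtain as bs where js: "js = as @ i # bs" by (meson split_list)
  have ms: "mset is = mset (as @ bs)" using Cons.prems(3) by (simp add: js)
  have len: "length (as @ bs) < m"
    using Cons.prems(1) ms by (metis Suc_le_eq length_Cons size_mset)
  have "pderivs js f x = pderivs as (pderivs (i # bs) f) x" by (simp add: js)
  also have "\<dots> = pderivs as (pderivs (bs @ [i]) f) x"
    using len by (intro pderivs_cong[OF assms(1) Cons.prems(2)] pderivs_rotate1[OF assms(1,2)]) auto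
  also have "\<dots> = pderivs ((as @ bs) @ [i]) f x" by simp
  also have "\<dots> = pderivs (i # (as @ bs)) f x"
    using pderivs_rotate1[OF assms(1,2) len Cons.prems(2)] by metis
  also have "\<dots> = partial_deriv i (pderivs (as @ bs) f) x" by simp
  also have "\<dots> = partial_deriv i (pderivs is f) x"
    using Cons.prems(1) ms by (intro partial_deriv_cong[OF assms(1) Cons.prems(2)] Cons.IH[symmetric]) auto
  finally show ?case by simp
qed simp

section \<open>Lists of directions and multi-indices\<close>

lemma length_eq_sum_count_list:
  "length is = (\<Sum>i\<in>UNIV. count_list is (i::'n::finite))"
  using sum_count_set[of "is" UNIV] by simp

text \<open>The list chosen in \<open>multi_deriv\<close> exists, with \<open>is\<close> as a
  witness, and is a permutation of \<open>is\<close>; so the choice is immaterial for C^m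
  functions.\<close>

lemma multi_deriv_eq_pderivs:
  fixes f :: "real^'n::finite \<Rightarrow> real"
  assumes "open U" "Cm_on m U f" "length is \<le> m" "x \<in> U"
  shows "multi_deriv (count_list is) f x = pderivs is f x"
proof -
  let ?js = "SOME js. \<forall>i. count_list js i = count_list is i"
  have js: "\<forall>i. count_list ?js i = count_list is i"
    by (rule someI[of _ "is"]) simp
  have "mset is = mset ?js"
    using js by (intro multiset_eqI) (simp add: count_mset)
  then show ?thesis
    unfolding multi_deriv_def by (rule pderivs_permute[OF assms, symmetric])
qed

lemma ex_count_list: "\<exists>is. \<forall>i::'n::finite. count_list is i = \<alpha> i"
proof -
  obtain "is" where "mset is = (\<Sum>i\<in>UNIV. replicate_mset (\<alpha> i) i)" using ex_mset by blast
  then have "count_list is i = (\<Sum>j\<in>UNIV. if i = j then \<alpha> j else 0)" for i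
    by (simp add: count_mset[symmetric] count_sum)
  then show ?thesis by (intro exI[of _ "is"]) simp
qed

lemma multi_index_list:
  assumes "\<alpha> \<in> multi_indices m"
  obtains "is" :: "'n::finite list" where "\<alpha> = count_list is" "length is \<le> m"
proof -
  obtain "is" where "\<forall>i. count_list is i = \<alpha> i" using ex_count_list by blast
  then have "\<alpha> = count_list is" by auto
  then show ?thesis using assms that length_eq_sum_count_list[of "is"] by (simp add: multi_indices_def)
qed

lemma count_list_in_multi_indices: "length is \<le> m \<Longrightarrow> count_list is \<in> multi_indices m"
  by (simp add: multi_indices_def length_eq_sum_count_list)

lemma finite_multi_indices: "finite (multi_indices m :: ('n::finite \<Rightarrow> nat) set)"
proof (rule finite_subset)
  show "multi_indices m \<subseteq> PiE (UNIV :: 'n set) (\<lambda>_. {..m})"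
  proof
    fix \<alpha> :: "'n \<Rightarrow> nat"
    assume "\<alpha> \<in> multi_indices m"
    then have "\<alpha> i \<le> m" for i
      using member_le_sum[of i UNIV \<alpha>] by (simp add: multi_indices_def)
    then show "\<alpha> \<in> PiE UNIV (\<lambda>_. {..m})" by (simp add: PiE_UNIV_domain)
  qed
qed (auto intro: finite_PiE)

section \<open>Linearity of iterated derivatives\<close>

lemma pderivs_add:
  assumes "open U" "Cm_on m U f" "Cm_on m U g" "length is \<le> m" "x \<in> U"
  shows "pderivs is (\<lambda>x. f x + g x) x = pderivs is f x + pderivs is g x"
  using assms(4,5)
proof (induction "is" arbitrary: x)
  case (Cons i "is")
  have C: "Cm_on (Suc 0) U (pderivs is f)" "Cm_on (Suc 0) U (pderivs is g)"
    using Cons.prems by (intro Cm_on_pderivs Cm_on_le[OF assms(2)] Cm_on_le[OF assms(3)]; simp)+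
  have "pderivs (i # is) (\<lambda>x. f x + g x) x = partial_deriv i (\<lambda>x. pderivs is f x + pderivs is g x) x"
    using Cons by (auto intro!: partial_deriv_cong[OF assms(1)])
  then show ?case using partial_deriv_add[OF C Cons.prems(2)] by simp
qed simp

lemma pderivs_const: "pderivs (is :: 'n::finite list) (\<lambda>x. c) x = (if is = [] then c else 0)"
proof -
  have e: "partial_deriv i (\<lambda>x::real^'n. c) = (\<lambda>x. 0)" for i :: 'n and c :: real
    by (intro ext partial_deriv_eqI) simp
  have "pderivs is (\<lambda>x::real^'n. c) = (if is = [] then \<lambda>x. c else (\<lambda>x. 0))"
    by (induction "is") (auto simp: e)
  then show ?thesis by simp
qed

lemma pderivs_cmult:
  assumes "open U" "Cm_on m U f" "length is \<le> m" "x \<in> U"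
  shows "pderivs is (\<lambda>x. c * f x) x = c * pderivs is f x"
  using assms(3,4)
proof (induction "is" arbitrary: x)
  case (Cons i "is")
  have C: "Cm_on (Suc 0) U (pderivs is f)"
    using Cons.prems by (intro Cm_on_pderivs Cm_on_le[OF assms(2)]) simp
  have "pderivs (i # is) (\<lambda>x. c * f x) x = partial_deriv i (\<lambda>x. c * pderivs is f x) x"
    using Cons by (auto intro!: partial_deriv_cong[OF assms(1)])
  also have "\<dots> = c * partial_deriv i (pderivs is f) x"
    by (intro partial_deriv_eqI DERIV_cmult Cm_on_has_partial_deriv[OF C Cons.prems(2)])
  finally show ?case by simp
qed simp

lemma pderivs_diff:
  assumes "open U" "Cm_on m U f" "Cm_on m U g" "length is \<le> m" "x \<in> U"
  shows "pderivs is (\<lambda>x. f x - g x) x = pderivs is f x - pderivs is g x"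
  using pderivs_add[OF assms(1,2) Cm_on_cmult[OF assms(1,3), of "-1"] assms(4,5)]
    pderivs_cmult[OF assms(1,3,4,5), of "-1"] by simp

lemma pderivs_sum:
  assumes "open U" "\<And>a. a \<in> A \<Longrightarrow> Cm_on m U (f a)" "length is \<le> m" "x \<in> U"
  shows "pderivs is (\<lambda>x. \<Sum>a\<in>A. f a x) x = (\<Sum>a\<in>A. pderivs is (f a) x)"
  using assms(2)
proof (induction A rule: infinite_finite_induct)
  case (insert a A)
  then show ?case
    using pderivs_add[OF assms(1), of m "f a" "\<lambda>x. \<Sum>a\<in>A. f a x" "is" x] assms
    by (auto simp: Cm_on_sum)
qed (auto simp: pderivs_const)

section \<open>Taylor coefficients at the origin\<close>

lemma Cm_on_monomial: "open U \<Longrightarrow> Cm_on m U (monomial \<alpha>)"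
  unfolding monomial_def by (intro Cm_on_prod Cm_on_power Cm_on_nth)

lemma monomial_zero: "monomial \<alpha> 0 = (if \<forall>i. \<alpha> i = 0 then 1 else 0)"
  by (auto simp: monomial_def power_0_left)

text \<open>For \<open>\<alpha> i = 0\<close> the truncated subtraction leaves the exponent 0, but
  then the factor \<open>real (\<alpha> i)\<close> vanishes as well.\<close>

lemma partial_deriv_monomial:
  fixes \<alpha> :: "'n::finite \<Rightarrow> nat"
  shows "partial_deriv i (monomial \<alpha>) = (\<lambda>x. real (\<alpha> i) * monomial (\<alpha>(i := \<alpha> i - 1)) x)"
proof
  fix x :: "real^'n"
  define c where "c = (\<Prod>j\<in>UNIV - {i}. x $ j ^ \<alpha> j)"
  have m: "monomial \<beta> (x + t *\<^sub>R axis i 1) = (x $ i + t) ^ \<beta> i * c"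
    if "\<And>j. j \<noteq> i \<Longrightarrow> \<beta> j = \<alpha> j" for \<beta> t
    unfolding monomial_def c_def
    by (subst prod.remove[of UNIV i]) (auto simp: axis_def that intro!: prod.cong)
  have "((\<lambda>t. (x $ i + t) ^ \<alpha> i * c) has_real_derivative real (\<alpha> i) * ((x $ i + 0) ^ (\<alpha> i - 1) * c)) (at 0)"
    by (auto intro!: derivative_eq_intros)
  then show "partial_deriv i (monomial \<alpha>) x = real (\<alpha> i) * monomial (\<alpha>(i := \<alpha> i - 1)) x"
    using m[of "\<alpha>(i := \<alpha> i - 1)" 0] by (intro partial_deriv_eqI) (simp add: m)
qed

text \<open>Derivatives at the origin and monomials are dual up to factorials, so a polynomial can
  be recovered from its derivatives at 0.\<close>

lemma pderivs_monomial_zero: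
  fixes \<alpha> :: "'n::finite \<Rightarrow> nat"
  shows "pderivs is (monomial \<alpha>) 0 = (if count_list is = \<alpha> then \<Prod>i\<in>UNIV. fact (\<alpha> i) else 0)"
proof (induction "is" arbitrary: \<alpha> rule: rev_induct)
  case Nil
  have "(\<forall>i. \<alpha> i = 0) \<longleftrightarrow> count_list [] = \<alpha>" by auto
  then show ?case by (auto simp: monomial_zero)
next
  case (snoc i "is")
  have "pderivs (is @ [i]) (monomial \<alpha>) 0 = real (\<alpha> i) * pderivs is (monomial (\<alpha>(i := \<alpha> i - 1))) 0"
    using pderivs_cmult[OF open_UNIV Cm_on_monomial[OF open_UNIV] order_refl UNIV_I]
    by (simp add: partial_deriv_monomial)
  also have "\<dots> = (if count_list (is @ [i]) = \<alpha> then \<Prod>i\<in>UNIV. fact (\<alpha> i) else 0)"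
  proof (cases "\<alpha> i")
    case 0
    then have "count_list (is @ [i]) \<noteq> \<alpha>" by (auto dest!: fun_cong[where x = i])
    then show ?thesis using 0 by simp
  next
    case (Suc k)
    have "count_list (is @ [i]) = \<alpha> \<longleftrightarrow> count_list is = \<alpha>(i := \<alpha> i - 1)"
      using Suc by (auto simp: fun_eq_iff split: if_splits)
    moreover have "real (\<alpha> i) * (\<Prod>j\<in>UNIV. fact ((\<alpha>(i := \<alpha> i - 1)) j)) = (\<Prod>j\<in>UNIV. fact (\<alpha> j))"
    proof -
      have "(\<Prod>j\<in>UNIV - {i}. fact ((\<alpha>(i := \<alpha> i - 1)) j) :: real) = (\<Prod>j\<in>UNIV - {i}. fact (\<alpha> j))"
        by (intro prod.cong) auto
      then show ?thesis
        by (subst (1 2) prod.remove[of UNIV i]) (auto simp: Suc)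
    qed
    ultimately show ?thesis by (simp add: snoc.IH del: fun_upd_apply)
  qed
  finally show ?case .
qed

lemma pderivs_poly_zero:
  assumes "length is \<le> m"
  shows "pderivs is (\<lambda>x. \<Sum>\<alpha>\<in>multi_indices m. c \<alpha> * monomial \<alpha> x) 0 =
    c (count_list is) * (\<Prod>i\<in>(UNIV::'n::finite set). fact (count_list is i))"
proof -
  have "pderivs is (\<lambda>x. \<Sum>\<alpha>\<in>multi_indices m. c \<alpha> * monomial \<alpha> x) 0 =
     (\<Sum>\<alpha>\<in>multi_indices m. c \<alpha> * pderivs is (monomial \<alpha>) 0)"
    by (simp add: pderivs_sum[of UNIV _ "length is"] pderivs_cmult[of UNIV "length is"]
        Cm_on_cmult Cm_on_monomial)
  also have "\<dots> = (\<Sum>\<alpha>\<in>multi_indices m. if count_list is = \<alpha> then c \<alpha> * (\<Prod>i\<in>UNIV. fact (\<alpha> i)) else 0)"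
    by (intro sum.cong) (auto simp: pderivs_monomial_zero)
  finally show ?thesis
    using assms by (simp add: finite_multi_indices count_list_in_multi_indices)
qed

lemma Cm_on_polys: "open U \<Longrightarrow> p \<in> polys m \<Longrightarrow> Cm_on k U p"
  unfolding polys_def by (auto intro!: Cm_on_sum Cm_on_cmult Cm_on_monomial)

lemma jet_in_polys: "jet m f \<in> polys m"
  unfolding jet_def polys_def
  by (intro CollectI exI[of _ "\<lambda>\<alpha>. multi_deriv \<alpha> f 0 / (\<Prod>i\<in>UNIV. fact (\<alpha> i))"]) simp

lemma pderivs_jet_zero:
  assumes "open U" "Cm_on m U f" "0 \<in> U" "length is \<le> m"
  shows "pderivs is (jet m f) 0 = pderivs is f 0"
  unfolding jet_def pderivs_poly_zero[OF assms(4)] multi_deriv_eq_pderivs[OF assms(1,2,4,3)]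
  by simp

lemma jet_eqI:
  assumes "open U" "Cm_on m U f" "0 \<in> U" "p \<in> polys m"
    and "\<And>is. length is \<le> m \<Longrightarrow> pderivs is f 0 = pderivs is p 0"
  shows "jet m f = p"
proof -
  obtain c where p: "p = (\<lambda>x. \<Sum>\<alpha>\<in>multi_indices m. c \<alpha> * monomial \<alpha> x)"
    using assms(4) unfolding polys_def by auto
  have "multi_deriv \<alpha> f 0 / (\<Prod>i\<in>UNIV. fact (\<alpha> i)) = c \<alpha>" if \<alpha>: "\<alpha> \<in> multi_indices m" for \<alpha>
  proof -
    obtain "is" where i: "\<alpha> = count_list is" "length is \<le> m" using multi_index_list[OF \<alpha>] .
    have "multi_deriv \<alpha> f 0 = pderivs is p 0"
      using multi_deriv_eq_pderivs[OF assms(1,2) i(2) assms(3)] assms(5)[OF i(2)] i(1) by simp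
    also have "\<dots> = c \<alpha> * (\<Prod>i\<in>UNIV. fact (\<alpha> i))"
      unfolding p by (simp add: pderivs_poly_zero[OF i(2)] i(1))
    finally show ?thesis by simp
  qed
  then show ?thesis unfolding jet_def p by simp
qed

section \<open>Flat functions\<close>

text \<open>A pointwise C^m bound in units of length \<rho>: each derivative costs a factor
  \<open>1/\<rho>\<close>. Taking \<open>C\<close> to be \<open>\<epsilon> * \<rho> ^ m\<close>
  gives the bound required of \<open>F\<close> in an implication, and \<open>C = A\<close> the one
  required of the \<open>S l\<close>; a single notion then handles their products.\<close>

definition deriv_bound :: "nat \<Rightarrow> real \<Rightarrow> real \<Rightarrow> (real^'n::finite \<Rightarrow> real) \<Rightarrow> real^'n \<Rightarrow> bool" where
  "deriv_bound m \<rho> C f x \<longleftrightarrow> (\<forall>is. length is \<le> m \<longrightarrow> \<bar>pderivs is f x\<bar> \<le> C / \<rho> ^ length is)"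

lemma deriv_bound_value: "deriv_bound m \<rho> C f x \<Longrightarrow> \<bar>f x\<bar> \<le> C"
  unfolding deriv_bound_def by (force dest: spec[of _ "[]"])

lemma deriv_bound_nonneg: "deriv_bound m \<rho> C f x \<Longrightarrow> 0 \<le> C"
  using deriv_bound_value abs_ge_zero order_trans by blast

text \<open>Splitting off the innermost derivative makes induction on \<open>m\<close> possible, the
  constant absorbing the lost factor \<rho>.\<close>

lemma deriv_bound_Suc:
  "deriv_bound (Suc m) \<rho> C f x \<longleftrightarrow> \<bar>f x\<bar> \<le> C \<and> (\<forall>i. deriv_bound m \<rho> (C / \<rho>) (partial_deriv i f) x)"
proof (intro iffI conjI allI)
  assume d: "deriv_bound (Suc m) \<rho> C f x"
  show "\<bar>f x\<bar> \<le> C" using deriv_bound_value[OF d] .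
  show "deriv_bound m \<rho> (C / \<rho>) (partial_deriv i f) x" for i
    unfolding deriv_bound_def
  proof (intro allI impI)
    fix "is" :: "'a list" assume "length is \<le> m"
    then show "\<bar>pderivs is (partial_deriv i f) x\<bar> \<le> C / \<rho> / \<rho> ^ length is"
      using d[unfolded deriv_bound_def, rule_format, of "is @ [i]"] by simp
  qed
next
  assume d: "\<bar>f x\<bar> \<le> C \<and> (\<forall>i. deriv_bound m \<rho> (C / \<rho>) (partial_deriv i f) x)"
  show "deriv_bound (Suc m) \<rho> C f x"
    unfolding deriv_bound_def
  proof (intro allI impI)
    fix "is" :: "'a list" assume l: "length is \<le> Suc m"
    show "\<bar>pderivs is f x\<bar> \<le> C / \<rho> ^ length is"
    proof (cases "is" rule: rev_cases)
      case (snoc js j)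
      then show ?thesis
        using l d[unfolded deriv_bound_def, THEN conjunct2, rule_format, of js j] by simp
    qed (use d in simp)
  qed
qed

lemma deriv_bound_mono:
  assumes "deriv_bound m \<rho> C f x" "0 < \<rho>" "C \<le> D"
  shows "deriv_bound m \<rho> D f x"
  using assms unfolding deriv_bound_def
  by (meson divide_right_mono order_trans zero_le_power less_imp_le)

lemma deriv_bound_Suc_D:
  "deriv_bound (Suc m) \<rho> C f x \<Longrightarrow> deriv_bound m \<rho> C f x"
  unfolding deriv_bound_def by simp

text \<open>Passing to a smaller scale only weakens the bound; enlarging the scale by at most a
  factor 2 costs at most 2 per derivative.\<close>

lemma deriv_bound_rescale:
  assumes d: "deriv_bound m \<rho> C f x" and "0 < \<rho>" "0 < \<sigma>" "\<sigma> \<le> 2 * \<rho>"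
  shows "deriv_bound m \<sigma> (2 ^ m * C) f x"
  unfolding deriv_bound_def
proof (intro allI impI)
  fix "is" :: "'a list" assume l: "length is \<le> m"
  let ?k = "length is"
  have C: "0 \<le> C" using d by (rule deriv_bound_nonneg)
  have "\<sigma> ^ ?k \<le> (2 * \<rho>) ^ ?k" using assms by (intro power_mono) auto
  also have "\<dots> \<le> 2 ^ m * \<rho> ^ ?k"
    using l assms by (simp add: power_mult_distrib power_increasing mult_right_mono)
  finally have "C * \<sigma> ^ ?k \<le> C * (2 ^ m * \<rho> ^ ?k)" using C by (rule mult_left_mono)
  then have "C / \<rho> ^ ?k \<le> 2 ^ m * C / \<sigma> ^ ?k"
    using assms by (simp add: field_simps)
  then show "\<bar>pderivs is f x\<bar> \<le> 2 ^ m * C / \<sigma> ^ ?k"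
    using d l unfolding deriv_bound_def by (meson order_trans)
qed

lemma deriv_bound_cong:
  assumes "open U" "x \<in> U" "\<And>y. y \<in> U \<Longrightarrow> f y = g y"
  shows "deriv_bound m \<rho> C f x \<longleftrightarrow> deriv_bound m \<rho> C g x"
  unfolding deriv_bound_def by (simp add: pderivs_cong[OF assms])

lemma deriv_bound_const_0: "0 < \<rho> \<Longrightarrow> 0 \<le> C \<Longrightarrow> deriv_bound m \<rho> C (\<lambda>x. 0) x"
  unfolding deriv_bound_def by (simp add: pderivs_const)

lemma deriv_bound_add:
  assumes "open U" "Cm_on m U f" "Cm_on m U g" "x \<in> U"
    and "deriv_bound m \<rho> C f x" "deriv_bound m \<rho> D g x"
  shows "deriv_bound m \<rho> (C + D) (\<lambda>x. f x + g x) x"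
  unfolding deriv_bound_def
proof (intro allI impI)
  fix "is" :: "'a list" assume l: "length is \<le> m"
  have "\<bar>pderivs is f x + pderivs is g x\<bar> \<le> C / \<rho> ^ length is + D / \<rho> ^ length is"
    using assms(5,6) l unfolding deriv_bound_def by (meson abs_triangle_ineq add_mono order_trans)
  then show "\<bar>pderivs is (\<lambda>x. f x + g x) x\<bar> \<le> (C + D) / \<rho> ^ length is"
    by (simp add: pderivs_add[OF assms(1-3) l assms(4)] add_divide_distrib)
qed

lemma deriv_bound_sum:
  assumes "open U" "\<And>a. a \<in> A \<Longrightarrow> Cm_on m U (f a)" "x \<in> U" "0 < \<rho>"
    and "\<And>a. a \<in> A \<Longrightarrow> deriv_bound m \<rho> (C a) (f a) x"
  shows "deriv_bound m \<rho> (\<Sum>a\<in>A. C a) (\<lambda>x. \<Sum>a\<in>A. f a x) x"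
  using assms(2,5)
proof (induction A rule: infinite_finite_induct)
  case (insert a A)
  then show ?case
    using deriv_bound_add[OF assms(1), of m "f a" "\<lambda>x. \<Sum>a\<in>A. f a x" x] assms(1,3)
    by (auto simp: Cm_on_sum)
qed (auto simp: deriv_bound_const_0 assms(4))

text \<open>The factor \<open>2 ^ m\<close> counts the terms of the Leibniz rule, which doubles
  their number at each differentiation.\<close>

lemma deriv_bound_mult:
  assumes "open U" "x \<in> U" "0 < \<rho>"
    and "Cm_on m U f" "Cm_on m U g"
    and "deriv_bound m \<rho> C f x" "deriv_bound m \<rho> D g x"
  shows "deriv_bound m \<rho> (2 ^ m * (C * D)) (\<lambda>x. f x * g x) x"
  using assms(4-7)
proof (induction m arbitrary: f g C D)
  case 0
  have "\<bar>f x * g x\<bar> \<le> C * D"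
    using 0(3,4)[THEN deriv_bound_value] deriv_bound_nonneg[OF 0(3)]
    by (simp add: abs_mult mult_mono)
  then show ?case by (simp add: deriv_bound_def)
next
  case (Suc m)
  have C: "0 \<le> C" "0 \<le> D" using Suc.prems(3,4) by (auto dest: deriv_bound_nonneg)
  have "\<bar>f x * g x\<bar> \<le> C * D"
    using Suc.prems(3,4)[THEN deriv_bound_value] C by (simp add: abs_mult mult_mono)
  also have "\<dots> \<le> 2 ^ Suc m * (C * D)"
    using C mult_right_mono[of 1 "2 ^ Suc m" "C * D"] by (simp del: power_Suc)
  finally have 1: "\<bar>f x * g x\<bar> \<le> 2 ^ Suc m * (C * D)" .
  have "deriv_bound m \<rho> (2 ^ Suc m * (C * D) / \<rho>) (partial_deriv i (\<lambda>x. f x * g x)) x" for i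
  proof -
    note Cm = Cm_on_Suc_D[OF Suc.prems(1)] Cm_on_Suc_D[OF Suc.prems(2)]
      Cm_on_Suc_partial[OF Suc.prems(1)] Cm_on_Suc_partial[OF Suc.prems(2)]
    have "deriv_bound m \<rho> (2 ^ m * (C / \<rho> * D) + 2 ^ m * (C * (D / \<rho>)))
        (\<lambda>x. partial_deriv i f x * g x + f x * partial_deriv i g x) x"
      using Suc.prems(3,4)[unfolded deriv_bound_Suc] Suc.prems(3,4)[THEN deriv_bound_Suc_D]
      by (intro deriv_bound_add[OF assms(1)] Cm_on_mult[OF assms(1)] Cm assms(2) Suc.IH) blast+
    moreover have "2 ^ m * (C / \<rho> * D) + 2 ^ m * (C * (D / \<rho>)) = 2 ^ Suc m * (C * D) / \<rho>"
      by (simp add: field_simps)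
    ultimately have *: "deriv_bound m \<rho> (2 ^ Suc m * (C * D) / \<rho>)
        (\<lambda>x. partial_deriv i f x * g x + f x * partial_deriv i g x) x" by (simp only:)
    have "partial_deriv i (\<lambda>x. f x * g x) y = partial_deriv i f y * g y + f y * partial_deriv i g y"
      if "y \<in> U" for y
      by (rule partial_deriv_eqI[OF has_partial_deriv_mult[OF Suc.prems(1,2) that]])
    then show ?thesis
      using * deriv_bound_cong[OF assms(1,2), of "partial_deriv i (\<lambda>x. f x * g x)"
          "\<lambda>x. partial_deriv i f x * g x + f x * partial_deriv i g x"] by blast
  qed
  then show ?case using 1 by (simp only: deriv_bound_Suc) simp
qed

text \<open>Derivatives of order k up to m are \<open>o(|x|^(m - k))\<close>. The filter
  \<open>at 0\<close> omits the origin, so the condition makes sense before any differentiability at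
  0 is known, and the value \<open>g 0\<close> has to be prescribed separately.\<close>

definition flat :: "nat \<Rightarrow> (real^'n::finite \<Rightarrow> real) \<Rightarrow> bool" where
  "flat m g \<longleftrightarrow> g 0 = 0 \<and>
     (\<forall>\<epsilon>>0. \<forall>\<^sub>F x in at 0. deriv_bound m (norm x) (\<epsilon> * norm x ^ m) g x)"

lemma flat_eventually:
  "flat m g \<Longrightarrow> \<epsilon> > 0 \<Longrightarrow> \<forall>\<^sub>F x in at 0. deriv_bound m (norm x) (\<epsilon> * norm x ^ m) g x"
  by (simp add: flat_def)

lemma eventually_norm_less: "r > 0 \<Longrightarrow> \<forall>\<^sub>F x in at (0 :: 'a::real_normed_vector). norm x < r"
  by (auto simp: eventually_at dist_norm)

text \<open>With at least one order to spare, \<open>g\<close> is \<open>o(|x|)\<close>, so its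
  difference quotients at the origin tend to 0. Hence the partial derivatives vanish at the origin,
  which is the missing half of their flatness.\<close>

lemma flat_Suc_partial:
  fixes g :: "real^'n::finite \<Rightarrow> real"
  assumes "flat (Suc m) g"
  shows "((\<lambda>t. g (0 + t *\<^sub>R axis i 1)) has_real_derivative 0) (at 0)" and "flat m (partial_deriv i g)"
proof -
  have g0: "g 0 = 0" using assms by (simp add: flat_def)
  show d: "((\<lambda>t. g (0 + t *\<^sub>R axis i 1)) has_real_derivative 0) (at 0)"
    unfolding DERIV_def
  proof (rule tendstoI)
    fix e :: real assume e: "e > 0"
    have "\<forall>\<^sub>F x in at (0::real^'n). \<bar>g x\<bar> < e * norm x"
    proof -
      have "\<forall>\<^sub>F x in at 0. deriv_bound (Suc m) (norm x) (e / 2 * norm x ^ Suc m) g x"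
        using e by (intro flat_eventually[OF assms]) simp
      moreover have "\<forall>\<^sub>F x in at (0::real^'n). norm x < 1" by (rule eventually_norm_less) simp
      moreover have "\<forall>\<^sub>F x in at (0::real^'n). x \<noteq> 0" by (auto simp: eventually_at intro: exI[of _ 1])
      ultimately show ?thesis
      proof eventually_elim
        case (elim x)
        have "\<bar>g x\<bar> \<le> e / 2 * norm x ^ Suc m" using elim(1) by (rule deriv_bound_value)
        also have "\<dots> \<le> e / 2 * norm x"
          using elim e by (intro mult_left_mono) (auto simp: mult_left_le power_le_one)
        also have "\<dots> < e * norm x" using elim e by simp
        finally show ?case .
      qed
    qed
    then obtain r where r: "r > 0" "\<And>x. x \<noteq> 0 \<Longrightarrow> norm x < r \<Longrightarrow> \<bar>g x\<bar> < e * norm x"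
      by (auto simp: eventually_at dist_norm)
    show "\<forall>\<^sub>F h in at 0. dist ((g (0 + (0 + h) *\<^sub>R axis i 1) - g (0 + 0 *\<^sub>R axis i 1)) / h) 0 < e"
      unfolding eventually_at
    proof (intro exI[of _ r] conjI ballI impI r(1))
      fix h :: real assume h: "h \<noteq> 0 \<and> dist h 0 < r"
      have "\<bar>g (h *\<^sub>R axis i 1)\<bar> < e * norm (h *\<^sub>R axis i (1::real))"
        using h by (intro r(2)) (auto simp: norm_axis_1)
      then show "dist ((g (0 + (0 + h) *\<^sub>R axis i 1) - g (0 + 0 *\<^sub>R axis i 1)) / h) 0 < e"
        using h by (simp add: g0 norm_axis_1 field_simps)
    qed
  qed
  have "\<forall>\<^sub>F x in at 0. deriv_bound m (norm x) (\<epsilon> * norm x ^ m) (partial_deriv i g) x" if "\<epsilon> > 0" for \<epsilon>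
  proof -
    have "\<forall>\<^sub>F x in at 0. deriv_bound (Suc m) (norm x) (\<epsilon> * norm x ^ Suc m) g x"
      using that by (rule flat_eventually[OF assms])
    moreover have "\<forall>\<^sub>F x in at (0::real^'n). x \<noteq> 0" by (auto simp: eventually_at intro: exI[of _ 1])
    ultimately show ?thesis
    proof eventually_elim
      case (elim x)
      then show ?case unfolding deriv_bound_Suc by (auto dest!: conjunct2 spec[of _ i])
    qed
  qed
  then show "flat m (partial_deriv i g)"
    using partial_deriv_eqI[OF d] by (simp add: flat_def)
qed

lemma flat_continuous:
  fixes g :: "real^'n::finite \<Rightarrow> real"
  assumes "continuous_on (-{0}) g" "flat m g"
  shows "continuous_on UNIV g"
proof -
  have "isCont g x" for x
  proof (cases "x = 0")
    case True
    have g0: "g 0 = 0" using assms by (simp add: flat_def)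
    have "(g \<longlongrightarrow> 0) (at 0)"
    proof (rule tendstoI)
      fix e :: real assume e: "e > 0"
      have "\<forall>\<^sub>F x in at 0. deriv_bound m (norm x) (e / 2 * norm x ^ m) g x"
        using e by (intro flat_eventually[OF assms(2)]) simp
      moreover have "\<forall>\<^sub>F x in at (0::real^'n). norm x < 1" by (rule eventually_norm_less) simp
      ultimately show "\<forall>\<^sub>F x in at 0. dist (g x) 0 < e"
      proof eventually_elim
        case (elim x)
        have "\<bar>g x\<bar> \<le> e / 2 * norm x ^ m" using elim(1) by (rule deriv_bound_value)
        also have "\<dots> \<le> e / 2 * 1"
          using elim e by (intro mult_left_mono power_le_one) auto
        finally show ?case using e by simp
      qed
    qed
    then show ?thesis using True g0 by (simp add: isCont_def)
  next
    case False
    then show ?thesis using assms(1) continuous_on_eq_continuous_at[of "-{0}" g] by auto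
  qed
  then show ?thesis by (simp add: continuous_at_imp_continuous_on)
qed

text \<open>A removable singularity statement: flatness gives differentiability at the origin and is
  inherited by the partial derivatives, one order lower, until only continuity remains.\<close>

lemma flat_imp_Cm_on:
  assumes "Cm_on m (-{0}) g" "flat m g"
  shows "Cm_on m UNIV g" and "\<And>is. length is \<le> m \<Longrightarrow> pderivs is g 0 = 0"
proof -
  have "Cm_on m UNIV g \<and> (\<forall>is. length is \<le> m \<longrightarrow> pderivs is g 0 = 0)"
    using assms
  proof (induction m arbitrary: g)
    case 0
    then show ?case using flat_continuous[of g 0] by (simp add: flat_def)
  next
    case (Suc m)
    have IH: "Cm_on m UNIV (partial_deriv i g)" "\<And>is. length is \<le> m \<Longrightarrow> pderivs is (partial_deriv i g) 0 = 0" for i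
      using Suc.IH[of "partial_deriv i g"] Suc.prems(1) flat_Suc_partial(2)[OF Suc.prems(2), of i] by auto
    have "(\<lambda>t. g (x + t *\<^sub>R axis i 1)) field_differentiable at 0" for i x
    proof (cases "x = 0")
      case True
      then show ?thesis
        using flat_Suc_partial(1)[OF Suc.prems(2), of i] by (auto simp: field_differentiable_def)
    qed (use Suc.prems(1) in auto)
    moreover have "continuous_on UNIV g"
      by (rule flat_continuous[OF Cm_on_imp_continuous[OF Suc.prems(1)] Suc.prems(2)])
    moreover have "pderivs is g 0 = 0" if l: "length is \<le> Suc m" for "is"
    proof (cases "is" rule: rev_cases)
      case Nil
      then show ?thesis using Suc.prems(2) by (simp add: flat_def)
    next
      case (snoc js j)
      then show ?thesis using IH(2)[of js j] l by simp
    qed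
    ultimately show ?case using IH(1) by simp
  qed
  then show "Cm_on m UNIV g" and "\<And>is. length is \<le> m \<Longrightarrow> pderivs is g 0 = 0" by auto
qed

text \<open>The points 0 and \<open>x\<close> are joined by a path of axis-parallel segments, one
  per coordinate, so that only partial derivatives enter and no chain rule is needed.\<close>

lemma abs_diff_zero_le_partial_deriv_bound:
  fixes g :: "real^'n::finite \<Rightarrow> real"
  assumes "Cm_on (Suc m) UNIV g" and B: "\<And>i y. norm y \<le> norm x \<Longrightarrow> \<bar>partial_deriv i g y\<bar> \<le> B"
  shows "\<bar>g x - g 0\<bar> \<le> real CARD('n) * (norm x * B)"
proof -
  \<comment> \<open>\<open>z S\<close> is \<open>x\<close> with the coordinates outside
    \<open>S\<close> set to 0. Adding an index to \<open>S\<close> moves along one axis, and the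
    segment stays in the ball of radius \<open>norm x\<close>.\<close>
  define z where "z S = (\<chi> i. if i \<in> S then x $ i else 0)" for S :: "'n set"
  have "\<bar>g (z S) - g 0\<bar> \<le> real (card S) * (norm x * B)" for S
  proof (induction S rule: finite_induct[OF finite])
    case 1
    have "z {} = 0" by (simp add: z_def vec_eq_iff)
    then show ?case by simp
  next
    case (2 i S)
    have z: "z (insert i S) = z S + (x $ i) *\<^sub>R axis i 1" "z S = z S + 0 *\<^sub>R axis i 1"
      using 2 by (auto simp: z_def vec_eq_iff axis_def)
    have B0: "0 \<le> B" using B[of 0 i] by (simp add: order_trans[OF abs_ge_zero])
    have "norm (g (z S + (x $ i) *\<^sub>R axis i 1) - g (z S + 0 *\<^sub>R axis i 1)) \<le> B * norm (x $ i - 0)"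
    proof (rule field_differentiable_bound[where S = "{-\<bar>x $ i\<bar>..\<bar>x $ i\<bar>}"
          and f' = "\<lambda>t. partial_deriv i g (z S + t *\<^sub>R axis i 1)"])
      fix t assume t: "t \<in> {-\<bar>x $ i\<bar>..\<bar>x $ i\<bar>}"
      show "((\<lambda>t. g (z S + t *\<^sub>R axis i 1)) has_real_derivative partial_deriv i g (z S + t *\<^sub>R axis i 1))
          (at t within {-\<bar>x $ i\<bar>..\<bar>x $ i\<bar>})"
        by (rule has_field_derivative_at_within[OF Cm_on_has_derivative_line[OF assms(1)]]) simp
      have "norm (z S + t *\<^sub>R axis i 1) \<le> norm x"
        using t 2 by (intro norm_le_componentwise_cart) (auto simp: z_def axis_def)
      then show "norm (partial_deriv i g (z S + t *\<^sub>R axis i 1)) \<le> B"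
        using B by simp
    qed auto
    also have "\<dots> \<le> norm x * B"
      using component_le_norm_cart[of x i] B0 by (simp add: mult.commute mult_left_mono)
    finally have "\<bar>g (z (insert i S)) - g (z S)\<bar> \<le> norm x * B" using z by simp
    then show ?case using 2 by (simp add: algebra_simps)
  qed
  from this[of UNIV] show ?thesis by (simp add: z_def)
qed

text \<open>Taylor's theorem for a zero jet, obtained by integrating the induction hypothesis for
  the partial derivatives along an axis-parallel path.\<close>

lemma Cm_on_imp_flat:
  fixes g :: "real^'n::finite \<Rightarrow> real"
  assumes "Cm_on m UNIV g" "\<And>is. length is \<le> m \<Longrightarrow> pderivs is g 0 = 0"
  shows "flat m g"
  using assms
proof (induction m arbitrary: g)
  case 0
  have g0: "g 0 = 0" using 0(2)[of "[]"] by simp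
  have "isCont g 0" using 0(1) by (simp add: continuous_on_eq_continuous_at)
  then have "(g \<longlongrightarrow> 0) (at 0)" using g0 by (simp add: isCont_def)
  then have "\<forall>\<^sub>F x in at 0. \<bar>g x\<bar> < e" if "e > 0" for e
    using tendstoD[OF _ that] by fastforce
  then have "\<forall>\<^sub>F x in at 0. \<bar>g x\<bar> \<le> e" if "e > 0" for e
    using that eventually_mono by (metis (mono_tags, lifting) less_imp_le)
  then show ?case using g0 by (simp add: flat_def deriv_bound_def)
next
  case (Suc m)
  have g0: "g 0 = 0" using Suc.prems(2)[of "[]"] by simp
  have p0: "partial_deriv i g 0 = 0" for i using Suc.prems(2)[of "[i]"] by simp
  have IH: "flat m (partial_deriv i g)" for i
    using Suc.prems(1) Suc.prems(2)[of "_ @ [i]"] by (intro Suc.IH) auto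
  have "\<forall>\<^sub>F x in at 0. deriv_bound (Suc m) (norm x) (\<epsilon> * norm x ^ Suc m) g x" if \<epsilon>: "\<epsilon> > 0" for \<epsilon>
  proof -
    \<comment> \<open>The path has \<open>CARD('n)\<close> segments, which share \<epsilon> among
      them.\<close>
    define e where "e = \<epsilon> / real CARD('n)"
    have e: "e > 0" "e \<le> \<epsilon>" "real CARD('n) * e = \<epsilon>"
      using \<epsilon> by (auto simp: e_def field_simps Suc_leI)
    have "\<forall>\<^sub>F x in at 0. \<forall>i. deriv_bound m (norm x) (e * norm x ^ m) (partial_deriv i g) x"
      using IH e(1) by (intro eventually_all_finite) (simp add: flat_def)
    then obtain r where r: "r > 0" "\<And>x i. x \<noteq> 0 \<Longrightarrow> norm x < r \<Longrightarrow>
        deriv_bound m (norm x) (e * norm x ^ m) (partial_deriv i g) x"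
      by (auto simp: eventually_at dist_norm)
    have "deriv_bound (Suc m) (norm x) (\<epsilon> * norm x ^ Suc m) g x" if x: "x \<noteq> 0" "norm x < r" for x
      unfolding deriv_bound_Suc
    proof (intro conjI allI)
      \<comment> \<open>The path meets points closer to 0 than \<open>x\<close>, including 0 itself,
        about which flatness says nothing; there \<open>p0\<close> is used.\<close>
      have "\<bar>partial_deriv i g y\<bar> \<le> e * norm x ^ m" if "norm y \<le> norm x" for i y
      proof (cases "y = 0")
        case False
        then have "\<bar>partial_deriv i g y\<bar> \<le> e * norm y ^ m"
          using r(2)[of y i] x that by (auto dest: deriv_bound_value)
        also have "\<dots> \<le> e * norm x ^ m" using that e by (intro mult_left_mono power_mono) auto
        finally show ?thesis .
      qed (use p0 e in auto)
      from abs_diff_zero_le_partial_deriv_bound[OF Suc.prems(1) this]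
      have "\<bar>g x\<bar> \<le> real CARD('n) * (norm x * (e * norm x ^ m))" using g0 by simp
      also have "\<dots> = (real CARD('n) * e) * norm x ^ Suc m" by simp
      finally show "\<bar>g x\<bar> \<le> \<epsilon> * norm x ^ Suc m" using e(3) by simp
      show "deriv_bound m (norm x) (\<epsilon> * norm x ^ Suc m / norm x) (partial_deriv i g) x" for i
        using x e by (intro deriv_bound_mono[OF r(2)[OF x]]) (auto intro: mult_right_mono)
    qed
    then show ?thesis using r(1) by (auto simp: eventually_at dist_norm)
  qed
  then show ?case using g0 by (simp add: flat_def)
qed

section \<open>Cutoffs and uniform bounds under dilation\<close>

lemma ex_cutoff:
  "\<exists>\<eta>. Cm_on m UNIV (\<eta> :: real^'n::finite \<Rightarrow> real) \<and> (\<forall>x. (norm x)\<^sup>2 \<le> 2 \<longrightarrow> \<eta> x = 1) \<and>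
     (\<forall>x. 3 \<le> (norm x)\<^sup>2 \<longrightarrow> \<eta> x = 0)"
proof -
  \<comment> \<open>The cutoff is \<open>a / (a + b)\<close>. The denominator never vanishes because
    the regions below 3 and above 2 overlap. The squared norm is a polynomial, hence of class C^m
    also at the origin. Both thresholds lie strictly between 1 and 4, which leaves room inside the
    dyadic annuli.\<close>
  define a b :: "real^'n \<Rightarrow> real" where
    "a x = max 0 (3 - (norm x)\<^sup>2) ^ Suc m" and "b x = max 0 ((norm x)\<^sup>2 - 2) ^ Suc m" for x
  have C: "Cm_on m UNIV a" "Cm_on m UNIV b"
    unfolding a_def b_def by (intro Cm_on_max0_power Cm_on_diff Cm_on_norm_square Cm_on_const open_UNIV)+
  have "a x > 0 \<or> b x > 0" "a x \<ge> 0" "b x \<ge> 0" for x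
    unfolding a_def b_def by (auto simp del: power_Suc intro!: zero_less_power)
  then have pos: "a x + b x \<noteq> 0" for x by (smt (verit))
  have "Cm_on m UNIV (\<lambda>x. a x * inverse (a x + b x))"
    by (intro Cm_on_mult Cm_on_inverse Cm_on_add C pos open_UNIV)
  moreover have "a x * inverse (a x + b x) = 1" if "(norm x)\<^sup>2 \<le> 2" for x
  proof -
    have "b x = 0" using that by (simp add: b_def)
    then show ?thesis using pos[of x] by simp
  qed
  moreover have "a x * inverse (a x + b x) = 0" if "3 \<le> (norm x)\<^sup>2" for x
    using that by (simp add: a_def)
  ultimately show ?thesis by (intro exI[of _ "\<lambda>x. a x * inverse (a x + b x)"]) simp
qed

lemma deriv_bound_of_bounded_support:
  fixes f :: "real^'n::finite \<Rightarrow> real"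
  assumes "Cm_on m UNIV f" "\<And>x. x \<notin> cball 0 R \<Longrightarrow> f x = 0"
  shows "\<exists>C>0. \<forall>x. deriv_bound m 1 C f x"
proof -
  have ex: "\<exists>C. \<forall>x. \<bar>pderivs is f x\<bar> \<le> C" if l: "length is \<le> m" for "is"
  proof -
    have "Cm_on 0 UNIV (pderivs is f)"
      using l by (intro Cm_on_pderivs Cm_on_le[OF assms(1)]) simp
    then have "compact (pderivs is f ` cball 0 R)"
      by (intro compact_continuous_image) (auto intro: continuous_on_subset)
    then obtain C where C: "\<And>x. x \<in> cball 0 R \<Longrightarrow> \<bar>pderivs is f x\<bar> \<le> C"
      using compact_imp_bounded bounded_iff by (metis image_eqI real_norm_def)
    \<comment> \<open>Outside the ball \<open>f\<close> vanishes on an open set, so the derivatives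
      are 0 there and only a nonnegative bound is needed.\<close>
    have "\<bar>pderivs is f x\<bar> \<le> max C 0" for x
    proof (cases "x \<in> cball 0 R")
      case False
      have "pderivs is f x = pderivs is (\<lambda>x. 0) x"
        by (rule pderivs_cong[of "- cball 0 R"]) (use False assms(2) in auto)
      then show ?thesis by (simp add: pderivs_const)
    qed (use C in force)
    then show ?thesis by blast
  qed
  then obtain C where C: "\<And>is x. length is \<le> m \<Longrightarrow> \<bar>pderivs is f x\<bar> \<le> C is" by metis
  let ?L = "{is :: 'n list. length is \<le> m}"
  have fin: "finite ?L" using finite_lists_length_le[of "UNIV :: 'n set" m] by simp
  have C0: "0 \<le> C is" if "length is \<le> m" for "is"
    using C[OF that, of undefined] by (rule order_trans[OF abs_ge_zero])
  have "\<bar>pderivs is f x\<bar> \<le> 1 + sum C ?L" if "length is \<le> m" for "is" x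
    using C[OF that, of x] member_le_sum[of "is" ?L C] C0 fin that by force
  moreover have "1 + sum C ?L > 0" using C0 by (intro add_pos_nonneg sum_nonneg) auto
  ultimately show ?thesis unfolding deriv_bound_def by auto
qed

lemma deriv_bound_dilate:
  assumes "Cm_on m UNIV f" "\<And>x. deriv_bound m 1 C f x" "0 < \<rho>"
  shows "deriv_bound m \<rho> C (\<lambda>x. f (x /\<^sub>R \<rho>)) x"
  unfolding deriv_bound_def
proof (intro allI impI)
  fix "is" :: "'a list" assume l: "length is \<le> m"
  have "\<bar>pderivs is f (x /\<^sub>R \<rho>)\<bar> \<le> C" using assms(2) l unfolding deriv_bound_def by simp
  then show "\<bar>pderivs is (\<lambda>x. f (x /\<^sub>R \<rho>)) x\<bar> \<le> C / \<rho> ^ length is"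
    using assms(3) pderivs_scale[OF assms(1) l, of "inverse \<rho>" x]
    by (simp add: abs_mult power_inverse field_simps)
qed

section \<open>Dyadic gluing\<close>

text \<open>At each scale take a candidate whose \<epsilon> exceeds the infimum of the attainable
  ones by less than \<rho>. The infimum need not be attained, but an excess that tends to 0 with
  \<rho> does no harm. At scales without candidates the choice is arbitrary.\<close>

lemma ex_select_uniform:
  assumes "\<And>\<epsilon>::real. \<epsilon> > 0 \<Longrightarrow> \<exists>r>0. \<forall>\<rho>::real. 0 < \<rho> \<and> \<rho> \<le> r \<longrightarrow> (\<exists>H. P \<epsilon> \<rho> H)"
    and mono: "\<And>\<epsilon> \<delta> \<rho> H. 0 < \<rho> \<Longrightarrow> P \<epsilon> \<rho> H \<Longrightarrow> \<epsilon> \<le> \<delta> \<Longrightarrow> P \<delta> \<rho> H"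
  shows "\<exists>H. \<forall>\<epsilon>>0. \<exists>r>0. \<forall>\<rho>. 0 < \<rho> \<and> \<rho> \<le> r \<longrightarrow> P \<epsilon> \<rho> (H \<rho>)"
proof -
  define e where "e \<rho> = Inf {\<epsilon>. 0 < \<epsilon> \<and> (\<exists>H. P \<epsilon> \<rho> H)}" for \<rho>
  have "\<exists>H. \<forall>\<epsilon>>0. (\<exists>H'. P \<epsilon> \<rho> H') \<longrightarrow> P (\<epsilon> + \<rho>) \<rho> H" if "\<rho> > 0" for \<rho>
  proof (cases "{\<epsilon>. 0 < \<epsilon> \<and> (\<exists>H. P \<epsilon> \<rho> H)} = {}")
    case False
    have "\<exists>\<epsilon>\<in>{\<epsilon>. 0 < \<epsilon> \<and> (\<exists>H. P \<epsilon> \<rho> H)}. \<epsilon> < e \<rho> + \<rho>"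
      unfolding e_def by (rule cInf_lessD[OF False]) (use that in simp)
    then obtain \<epsilon>' H where H: "\<epsilon>' < e \<rho> + \<rho>" "P \<epsilon>' \<rho> H" by auto
    have "e \<rho> \<le> \<epsilon>" if "\<epsilon> > 0" "P \<epsilon> \<rho> H'" for \<epsilon> H'
      unfolding e_def by (rule cInf_lower) (use that in \<open>auto intro!: bdd_belowI[of _ 0]\<close>)
    then have "P (\<epsilon> + \<rho>) \<rho> H" if "\<epsilon> > 0" "P \<epsilon> \<rho> H'" for \<epsilon> H'
      using that H by (intro mono[OF \<open>\<rho> > 0\<close> H(2)]) force
    then show ?thesis by blast
  qed auto
  then obtain H where H: "\<And>\<rho> \<epsilon> H'. \<rho> > 0 \<Longrightarrow> \<epsilon> > 0 \<Longrightarrow> P \<epsilon> \<rho> H' \<Longrightarrow> P (\<epsilon> + \<rho>) \<rho> (H \<rho>)" by metis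
  have "\<exists>r>0. \<forall>\<rho>. 0 < \<rho> \<and> \<rho> \<le> r \<longrightarrow> P \<epsilon> \<rho> (H \<rho>)" if \<epsilon>: "\<epsilon> > 0" for \<epsilon>
  proof -
    obtain r where r: "r > 0" "\<And>\<rho>. 0 < \<rho> \<and> \<rho> \<le> r \<Longrightarrow> \<exists>H. P (\<epsilon> / 2) \<rho> H"
      using assms(1)[OF half_gt_zero[OF \<epsilon>]] by blast
    \<comment> \<open>A scale of at most \<open>\<epsilon> / 2\<close> absorbs the excess.\<close>
    have "P \<epsilon> \<rho> (H \<rho>)" if \<rho>: "0 < \<rho>" "\<rho> \<le> min r (\<epsilon> / 2)" for \<rho>
    proof -
      obtain H' where "P (\<epsilon> / 2) \<rho> H'" using r(2)[of \<rho>] \<rho> by auto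
      then have "P (\<epsilon> / 2 + \<rho>) \<rho> (H \<rho>)" using H that by simp
      then show ?thesis by (rule mono[OF that(1)]) (use that in simp)
    qed
    then show ?thesis using r(1) \<open>\<epsilon> > 0\<close> by (intro exI[of _ "min r (\<epsilon> / 2)"]) auto
  qed
  then show ?thesis by blast
qed

section \<open>Dyadic partition of unity\<close>

lemma open_annulus: "open (annulus K \<rho>)"
  unfolding annulus_def by (intro open_Collect_conj open_Collect_less continuous_intros)

text \<open>The last clause speaks of a common value \<open>c\<close> at a single point because the
  pieces are tied to each other only on \<open>E\<close>, which is not open. The weights add up to
  the cutoff \<open>\<psi>\<close> off the origin, so a common value is reproduced up to that
  factor.\<close>

lemma ex_dyadic_glue:
  fixes H :: "real \<Rightarrow> real^'n::finite \<Rightarrow> real"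
  assumes R: "R > 0"
    and C: "\<And>\<rho>. 0 < \<rho> \<Longrightarrow> \<rho> \<le> R \<Longrightarrow> Cm_on m (annulus 2 \<rho>) (H \<rho>)"
    and small: "\<And>\<epsilon>. \<epsilon> > 0 \<Longrightarrow> \<exists>r>0. \<forall>\<rho>. 0 < \<rho> \<and> \<rho> \<le> r \<longrightarrow>
      (\<forall>x\<in>annulus 2 \<rho>. deriv_bound m \<rho> (\<epsilon> * \<rho> ^ m) (H \<rho>) x)"
  shows "\<exists>G \<psi>. Cm_on m (-{0}) G \<and> flat m G \<and> Cm_on m UNIV \<psi> \<and>
    (\<exists>U. open U \<and> 0 \<in> U \<and> (\<forall>x\<in>U. \<psi> x = 1)) \<and>
    (\<forall>x c. x \<noteq> 0 \<longrightarrow> (\<forall>\<rho>. 0 < \<rho> \<and> \<rho> \<le> R \<and> x \<in> annulus 2 \<rho> \<longrightarrow> H \<rho> x = c) \<longrightarrow> G x = \<psi> x * c)"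
proof -
  obtain \<eta> :: "real^'n \<Rightarrow> real" where \<eta>: "Cm_on m UNIV \<eta>"
    "\<And>x. (norm x)\<^sup>2 \<le> 2 \<Longrightarrow> \<eta> x = 1" "\<And>x. 3 \<le> (norm x)\<^sup>2 \<Longrightarrow> \<eta> x = 0"
    using ex_cutoff[of m] by blast
  \<comment> \<open>The difference of two successive dilates of \<open>\<eta>\<close> makes the
    weights \<open>\<theta> (x / \<rho> k)\<close> telescope. It vanishes unless
    \<open>1/2 < |x|^2 < 3\<close>, well inside the annulus \<open>1/4 < |x|^2 < 4\<close>.\<close>
  define \<theta> where "\<theta> x = \<eta> x - \<eta> (2 *\<^sub>R x)" for x
  have \<theta>C: "Cm_on m UNIV \<theta>"
    unfolding \<theta>_def by (intro Cm_on_diff \<eta>(1) Cm_on_scale open_UNIV)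
  have \<theta>0: "\<theta> x = 0" if "2 * (norm x)\<^sup>2 \<le> 1 \<or> 3 \<le> (norm x)\<^sup>2" for x
    using that \<eta>(2)[of x] \<eta>(3)[of x] \<eta>(2)[of "2 *\<^sub>R x"] \<eta>(3)[of "2 *\<^sub>R x"]
    by (auto simp: \<theta>_def power_mult_distrib)
  have "\<theta> x = 0" if "x \<notin> cball 0 2" for x
  proof -
    have "2\<^sup>2 \<le> (norm x)\<^sup>2" using that by (intro power_mono) auto
    then show ?thesis by (intro \<theta>0) simp
  qed
  then obtain K where K: "K > 0" "\<And>x. deriv_bound m 1 K \<theta> x"
    using deriv_bound_of_bounded_support[OF \<theta>C, of 2] by blast
  define \<rho> where "\<rho> k = R / 2 ^ k" for k :: nat
  have \<rho>: "\<rho> k > 0" "\<rho> k \<le> R" "\<rho> k = 2 * \<rho> (Suc k)" for k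
    using R by (auto simp: \<rho>_def field_simps)
  have \<rho>_mono: "\<rho> l \<le> \<rho> k" if "k \<le> l" for k l
    unfolding \<rho>_def using that R by (intro divide_left_mono) auto
  have \<rho>_lim: "\<exists>k. \<rho> k < e" if "e > 0" for e
  proof -
    obtain k where "R / e < 2 ^ k" using real_arch_pow[of 2 "R / e"] by auto
    then show ?thesis using that by (intro exI[of _ k]) (simp add: \<rho>_def field_simps)
  qed
  define T where "T k x = \<theta> (x /\<^sub>R \<rho> k) * H (\<rho> k) x" for k x
  have T0: "T k x = 0" if "2 * (norm x)\<^sup>2 \<le> (\<rho> k)\<^sup>2 \<or> 3 * (\<rho> k)\<^sup>2 \<le> (norm x)\<^sup>2" for k x
  proof -
    have "2 * (norm (x /\<^sub>R \<rho> k))\<^sup>2 \<le> 1 \<or> 3 \<le> (norm (x /\<^sub>R \<rho> k))\<^sup>2"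
      using that \<rho>(1)[of k] by (simp add: power_mult_distrib field_simps)
    then show ?thesis using \<theta>0 by (simp add: T_def)
  qed
  \<comment> \<open>On this open set the weight vanishes, whatever \<open>H (\<rho> k)\<close> does
    there. It covers everything outside the annulus, so \<open>T k\<close> is of class C^m on the
    whole space although \<open>H (\<rho> k)\<close> is controlled only on the annulus.\<close>
  define V where "V k = {x :: real^'n. 2 * (norm x)\<^sup>2 < (\<rho> k)\<^sup>2 \<or> 3 * (\<rho> k)\<^sup>2 < (norm x)\<^sup>2}" for k
  have oV: "open (V k)" for k
    unfolding V_def by (intro open_Collect_disj open_Collect_less continuous_intros)
  have V: "x \<in> V k" if "x \<notin> annulus 2 (\<rho> k)" for x k
  proof (cases "norm x \<le> \<rho> k / 2")
    case True
    then have "(norm x)\<^sup>2 \<le> (\<rho> k / 2)\<^sup>2" by (intro power_mono) auto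
    then have "4 * (norm x)\<^sup>2 \<le> (\<rho> k)\<^sup>2" by (simp add: power_divide)
    moreover have "0 < (\<rho> k)\<^sup>2" using \<rho>(1)[of k] by simp
    ultimately have "2 * (norm x)\<^sup>2 < (\<rho> k)\<^sup>2" by linarith
    then show ?thesis by (simp add: V_def)
  next
    case False
    then have "2 * \<rho> k \<le> norm x" using that by (auto simp: annulus_def)
    then have "(2 * \<rho> k)\<^sup>2 \<le> (norm x)\<^sup>2" using \<rho>(1)[of k] by (intro power_mono) auto
    then have "4 * (\<rho> k)\<^sup>2 \<le> (norm x)\<^sup>2" by (simp add: power_mult_distrib)
    moreover have "0 < (\<rho> k)\<^sup>2" using \<rho>(1)[of k] by simp
    ultimately have "3 * (\<rho> k)\<^sup>2 < (norm x)\<^sup>2" by linarith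
    then show ?thesis by (simp add: V_def)
  qed
  have TV: "T k x = 0" if "x \<in> V k" for k x
    using that T0 by (auto simp: V_def)
  have \<theta>kC: "Cm_on m (annulus 2 (\<rho> k)) (\<lambda>x. \<theta> (x /\<^sub>R \<rho> k))" for k
    by (rule Cm_on_subset[OF Cm_on_scale[OF \<theta>C]]) simp
  have TC: "Cm_on m UNIV (T k)" for k
  proof (rule Cm_on_local)
    fix x
    show "\<exists>W. open W \<and> x \<in> W \<and> Cm_on m W (T k)"
    proof (cases "x \<in> annulus 2 (\<rho> k)")
      case True
      have "Cm_on m (annulus 2 (\<rho> k)) (T k)"
        unfolding T_def by (intro Cm_on_mult open_annulus \<theta>kC C \<rho>)
      then show ?thesis using True open_annulus by blast
    next
      case False
      have "Cm_on m (V k) (T k)"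
        using Cm_on_cong[OF oV TV] by simp
      then show ?thesis using V[OF False] oV by blast
    qed
  qed
  have Tb: "deriv_bound m (\<rho> k) (2 ^ m * (K * D)) (T k) x"
    if D: "D \<ge> 0" and b: "\<And>x. x \<in> annulus 2 (\<rho> k) \<Longrightarrow> deriv_bound m (\<rho> k) D (H (\<rho> k)) x" for k D x
  proof (cases "x \<in> annulus 2 (\<rho> k)")
    case True
    then show ?thesis
      unfolding T_def
      by (intro deriv_bound_mult[OF open_annulus True] True \<theta>kC C \<rho> b deriv_bound_dilate[OF \<theta>C K(2)])
  next
    case False
    show ?thesis
      using deriv_bound_cong[OF oV V[OF False], of "T k" "\<lambda>_. 0"] TV
        deriv_bound_const_0[OF \<rho>(1), of "2 ^ m * (K * D)" m k x] D K(1) by simp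
  qed
  define G where "G x = (\<Sum>k. T k x)" for x
  have \<rho>sq: "(\<rho> k)\<^sup>2 = 4 * (\<rho> (Suc k))\<^sup>2" for k
    using \<rho>(3)[of k] by (simp add: power_mult_distrib)
  have \<rho>sq_mono: "(\<rho> l)\<^sup>2 \<le> (\<rho> k)\<^sup>2" if "k \<le> l" for k l
    using \<rho>_mono[OF that] \<rho>(1)[of l] by (intro power_mono) auto
  \<comment> \<open>Since \<open>(\<rho> N)^2\<close> is four times
    \<open>(\<rho> (Suc N))^2\<close>, the condition says
    \<open>3 * (\<rho> (Suc N))^2 < |x|^2\<close>: \<open>x\<close> lies beyond the supports of all
    pieces with index above \<open>N\<close>, and the series is a finite sum on an open set.\<close>
  define W where "W N = {x :: real^'n. 3 * (\<rho> N)\<^sup>2 < 4 * (norm x)\<^sup>2}" for N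
  have oW: "open (W N)" for N
    unfolding W_def by (intro open_Collect_less continuous_intros)
  have T_tail: "T k x = 0" if "x \<in> W N" "N < k" for x N k
  proof (rule T0)
    have "(\<rho> k)\<^sup>2 \<le> (\<rho> (Suc N))\<^sup>2" using that by (intro \<rho>sq_mono) simp
    then show "2 * (norm x)\<^sup>2 \<le> (\<rho> k)\<^sup>2 \<or> 3 * (\<rho> k)\<^sup>2 \<le> (norm x)\<^sup>2"
      using that \<rho>sq[of N] by (simp add: W_def)
  qed
  have GW: "G x = (\<Sum>k<Suc N. T k x)" if "x \<in> W N" for x N
    unfolding G_def by (rule suminf_finite) (use T_tail[OF that] in auto)
  have exW: "\<exists>N. x \<in> W N" if "x \<noteq> 0" for x
  proof -
    have "0 < norm x" using that by simp
    then obtain N where N: "\<rho> N < norm x" using \<rho>_lim by blast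
    then have "(\<rho> N)\<^sup>2 < (norm x)\<^sup>2" using \<rho>(1)[of N] by (intro power_strict_mono) auto
    moreover have "0 < (\<rho> N)\<^sup>2" using \<rho>(1)[of N] by simp
    ultimately show ?thesis unfolding W_def by (intro exI[of _ N] CollectI) linarith
  qed
  have GC: "Cm_on m (-{0}) G"
  proof (rule Cm_on_local)
    fix x :: "real^'n" assume "x \<in> -{0}"
    then obtain N where N: "x \<in> W N" using exW by auto
    have "Cm_on m (W N) (\<lambda>x. \<Sum>k<Suc N. T k x)"
      by (intro Cm_on_sum oW Cm_on_subset[OF TC]) simp
    then have "Cm_on m (W N) G" using Cm_on_cong[OF oW GW] by simp
    then show "\<exists>V. open V \<and> x \<in> V \<and> Cm_on m V G" using N oW by blast
  qed
  have G0: "G 0 = 0" unfolding G_def using T0[of 0] by simp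
  have flatG: "flat m G"
    unfolding flat_def
  proof (intro conjI allI impI G0)
    fix \<epsilon> :: real assume \<epsilon>: "\<epsilon> > 0"
    \<comment> \<open>One factor 2 is for the two pieces alive near a point. The factors
      \<open>2 ^ m\<close> come from the Leibniz rule, from changing the scale
      \<open>\<rho> k\<close> to \<open>norm x\<close>, and from
      \<open>\<rho> k \<le> 2 * norm x\<close>; \<open>K\<close> bounds the weights.\<close>
    define D where "D = \<epsilon> / (2 * 2 ^ m * 2 ^ m * 2 ^ m * K)"
    have D: "D > 0" using \<epsilon> K by (simp add: D_def)
    obtain r where r: "r > 0" "\<And>\<rho> x. 0 < \<rho> \<Longrightarrow> \<rho> \<le> r \<Longrightarrow> x \<in> annulus 2 \<rho> \<Longrightarrow>
        deriv_bound m \<rho> (D * \<rho> ^ m) (H \<rho>) x"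
      using small[OF D] by blast
    obtain N where N: "\<rho> N < r" using \<rho>_lim r(1) by blast
    have "\<forall>\<^sub>F x in at (0::real^'n). norm x < \<rho> N" by (rule eventually_norm_less[OF \<rho>(1)])
    moreover have "\<forall>\<^sub>F x in at (0::real^'n). x \<noteq> 0" by (auto simp: eventually_at intro: exI[of _ 1])
    ultimately show "\<forall>\<^sub>F x in at 0. deriv_bound m (norm x) (\<epsilon> * norm x ^ m) G x"
    proof eventually_elim
      case (elim x)
      have ex: "\<exists>k. \<rho> k \<le> norm x" using \<rho>_lim[of "norm x"] elim by (auto intro: less_imp_le)
      \<comment> \<open>This gives \<open>\<rho> (Suc M) \<le> norm x < \<rho> M\<close> for
        \<open>j = Suc M\<close>; the predecessor exists because \<open>x\<close> is closer to 0
        than \<open>\<rho> N\<close>.\<close>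
      define j where "j = (LEAST k. \<rho> k \<le> norm x)"
      have j: "\<rho> j \<le> norm x" unfolding j_def by (rule LeastI_ex[OF ex])
      have "N < j" using elim(1) j \<rho>_mono[of j N] by (meson leI less_le_not_le order_trans)
      then obtain M where M: "j = Suc M" "N \<le> M" by (cases j) auto
      have xM: "norm x < \<rho> M"
        using not_less_Least[of M "\<lambda>k. \<rho> k \<le> norm x"] M by (simp add: j_def)
      \<comment> \<open>Comparing derivatives needs a neighbourhood of \<open>x\<close> on which
        only two pieces survive. The set \<open>W (Suc M)\<close> removes the finer pieces, and the
        bound \<open>|y|^2 < 2 * (\<rho> M)^2\<close>, written at scale
        \<open>\<rho> (Suc M)\<close>, the coarser ones.\<close>
      define Y where "Y = W (Suc M) \<inter> {y. (norm y)\<^sup>2 < 8 * (\<rho> (Suc M))\<^sup>2}"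
      have oY: "open Y"
        unfolding Y_def by (intro open_Int oW open_Collect_less continuous_intros)
      have GY: "G y = T M y + T (Suc M) y" if "y \<in> Y" for y
      proof -
        have "T k y = 0" if "k < M" for k
        proof (rule T0)
          have "(\<rho> M)\<^sup>2 * 4 \<le> (\<rho> k)\<^sup>2" using that \<rho>sq_mono[of "Suc k" M] \<rho>sq[of k] by simp
          then show "2 * (norm y)\<^sup>2 \<le> (\<rho> k)\<^sup>2 \<or> 3 * (\<rho> k)\<^sup>2 \<le> (norm y)\<^sup>2"
            using \<open>y \<in> Y\<close> \<rho>sq[of M] by (simp add: Y_def)
        qed
        then show ?thesis using GW[of y "Suc M"] that by (simp add: Y_def)
      qed
      have "(\<rho> (Suc M))\<^sup>2 \<le> (norm x)\<^sup>2" using j M \<rho>(1)[of "Suc M"] by (intro power_mono) auto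
      moreover have "(norm x)\<^sup>2 < (\<rho> M)\<^sup>2" using xM by (intro power_strict_mono) auto
      moreover have "0 < (\<rho> (Suc M))\<^sup>2" using \<rho>(1)[of "Suc M"] by simp
      ultimately have xY: "x \<in> Y" using \<rho>sq[of M] by (simp add: Y_def W_def)
      have TM: "deriv_bound m (norm x) (\<epsilon> / 2 * norm x ^ m) (T k) x" if k: "k = M \<or> k = Suc M" for k
      proof -
        have "\<rho> k \<le> \<rho> M" using k \<rho>_mono[of M k] by auto
        then have x2: "norm x \<le> 2 * \<rho> k" "\<rho> k \<le> 2 * norm x" "\<rho> k \<le> r"
          using k xM j M \<rho>(3)[of M] \<rho>(1)[of M] \<rho>_mono[of N M] N by auto
        have "deriv_bound m (norm x) (2 ^ m * (2 ^ m * (K * (D * \<rho> k ^ m)))) (T k) x"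
          using x2 elim D \<rho>(1)[of k]
          by (intro deriv_bound_rescale[OF Tb] r(2)) auto
        moreover have "2 ^ m * (2 ^ m * (K * (D * \<rho> k ^ m))) \<le> \<epsilon> / 2 * norm x ^ m"
        proof -
          have "\<rho> k ^ m \<le> (2 * norm x) ^ m" using x2 \<rho>(1)[of k] by (intro power_mono) auto
          then have "2 ^ m * (2 ^ m * (K * (D * \<rho> k ^ m))) \<le> 2 ^ m * (2 ^ m * (K * (D * (2 * norm x) ^ m)))"
            using D K(1) by (intro mult_left_mono) auto
          also have "\<dots> = \<epsilon> / 2 * norm x ^ m"
            using K(1) by (simp add: D_def power_mult_distrib)
          finally show ?thesis .
        qed
        ultimately show ?thesis using elim by (auto intro: deriv_bound_mono)
      qed
      have "deriv_bound m (norm x) (\<epsilon> / 2 * norm x ^ m + \<epsilon> / 2 * norm x ^ m) (\<lambda>y. T M y + T (Suc M) y) x"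
        by (intro deriv_bound_add[OF open_UNIV] TC TM UNIV_I) auto
      then show ?case
        using deriv_bound_cong[OF oY xY GY] by simp
    qed
  qed
  \<comment> \<open>This is the first term of the telescoping sum, as
    \<open>\<rho> 0 = R\<close>.\<close>
  define \<psi> where "\<psi> x = \<eta> (x /\<^sub>R R)" for x
  have \<psi>C: "Cm_on m UNIV \<psi>" unfolding \<psi>_def by (rule Cm_on_scale[OF \<eta>(1)])
  have \<psi>1: "\<exists>U. open U \<and> 0 \<in> U \<and> (\<forall>x\<in>U. \<psi> x = 1)"
  proof (intro exI conjI ballI)
    show "\<psi> x = 1" if "x \<in> ball 0 R" for x
    proof -
      have "norm (x /\<^sub>R R) \<le> 1" using that R by (simp add: field_simps)
      then have "(norm (x /\<^sub>R R))\<^sup>2 \<le> 1\<^sup>2" by (intro power_mono) auto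
      then show ?thesis unfolding \<psi>_def by (intro \<eta>(2)) simp
    qed
  qed (use R in auto)
  have glue: "G x = \<psi> x * c" if "x \<noteq> 0" and
    c: "\<And>\<rho>. 0 < \<rho> \<Longrightarrow> \<rho> \<le> R \<Longrightarrow> x \<in> annulus 2 \<rho> \<Longrightarrow> H \<rho> x = c" for x c
  proof -
    obtain N where N: "x \<in> W N" using exW \<open>x \<noteq> 0\<close> by blast
    \<comment> \<open>Where \<open>x\<close> is outside the annulus, \<open>H (\<rho> k) x\<close>
      is unknown, but the weight is 0 and both sides vanish.\<close>
    have "T k x = (\<eta> (x /\<^sub>R \<rho> k) - \<eta> (x /\<^sub>R \<rho> (Suc k))) * c" for k
    proof (cases "x \<in> annulus 2 (\<rho> k)")
      case True
      have "inverse (\<rho> (Suc k)) = 2 * inverse (\<rho> k)" using \<rho>(3)[of k] by simp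
      then show ?thesis using c[OF \<rho>(1,2) True] by (simp add: T_def \<theta>_def)
    next
      case False
      then have "\<theta> (x /\<^sub>R \<rho> k) = 0"
        using V[OF False] \<rho>(1)[of k] by (intro \<theta>0) (auto simp: V_def power_mult_distrib field_simps)
      moreover have "inverse (\<rho> (Suc k)) = 2 * inverse (\<rho> k)" using \<rho>(3)[of k] by simp
      ultimately show ?thesis by (simp add: T_def \<theta>_def)
    qed
    then have "G x = (\<Sum>k<Suc N. \<eta> (x /\<^sub>R \<rho> k) - \<eta> (x /\<^sub>R \<rho> (Suc k))) * c"
      unfolding GW[OF N] by (simp only: sum_distrib_right)
    also have "\<dots> = (\<eta> (x /\<^sub>R \<rho> 0) - \<eta> (x /\<^sub>R \<rho> (Suc N))) * c"
      by (simp only: sum_lessThan_telescope'[of "\<lambda>k. \<eta> (x /\<^sub>R \<rho> k)"])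
    also have "\<eta> (x /\<^sub>R \<rho> (Suc N)) = 0"
      using N \<rho>sq[of N] \<rho>(1)[of "Suc N"] by (intro \<eta>(3)) (simp add: W_def power_mult_distrib field_simps)
    finally show ?thesis by (simp add: \<psi>_def \<rho>_def)
  qed
  then have "\<forall>x c. x \<noteq> 0 \<longrightarrow> (\<forall>\<rho>. 0 < \<rho> \<and> \<rho> \<le> R \<and> x \<in> annulus 2 \<rho> \<longrightarrow> H \<rho> x = c) \<longrightarrow> G x = \<psi> x * c"
    by blast
  with flatG \<psi>C \<psi>1 GC show ?thesis by (intro exI[of _ G] exI[of _ \<psi>] conjI)
qed

section \<open>Implied jets\<close>

lemma vanishing_jet_eq_flat_on:
  assumes "Q \<in> vanishing_jets m E"
  shows "\<exists>g. Cm_on m UNIV g \<and> flat m g \<and> (\<forall>x\<in>E. Q x = g x)"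
proof -
  obtain f where f: "Q = jet m f" "Cm_on m UNIV f" "\<forall>x\<in>E. f x = 0"
    using assms by (auto simp: vanishing_jets_def)
  have Q: "Cm_on m UNIV Q" unfolding f(1) by (rule Cm_on_polys[OF open_UNIV jet_in_polys])
  have C: "Cm_on m UNIV (\<lambda>x. Q x - f x)" by (intro Cm_on_diff Q f(2) open_UNIV)
  have "pderivs is (\<lambda>x. Q x - f x) 0 = 0" if "length is \<le> m" for "is"
    using pderivs_diff[OF open_UNIV Q f(2) that UNIV_I] pderivs_jet_zero[OF open_UNIV f(2) UNIV_I that]
    by (simp add: f(1))
  then have "flat m (\<lambda>x. Q x - f x)" by (intro Cm_on_imp_flat[OF C])
  then show ?thesis using C f(3) by (intro exI[of _ "\<lambda>x. Q x - f x"]) auto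
qed

text \<open>Otherwise a sequence in \<open>E\<close> violating the claim has a limit direction.
  Polynomials forbidding that direction would coincide on \<open>E\<close> with flat functions,
  hence be \<open>o(|x|^m)\<close> along the sequence, which eventually enters every sector around
  the limit. If no direction is allowed, the claim says that 0 is the only point of \<open>E\<close>
  near the origin.\<close>

lemma direction_near_Allow:
  fixes E :: "(real^'n::finite) set"
  assumes "\<delta> > 0"
  shows "\<exists>r>0. \<forall>x\<in>E. 0 < norm x \<and> norm x < r \<longrightarrow>
    ext_dist (x /\<^sub>R norm x) (Allow m (vanishing_jets m E)) < ereal \<delta>"
proof (rule ccontr)
  let ?I = "vanishing_jets m E"
  assume "\<not> ?thesis"
  then have "\<forall>r>0. \<exists>x. x \<in> E \<and> 0 < norm x \<and> norm x < r \<and> \<not> ext_dist (x /\<^sub>R norm x) (Allow m ?I) < ereal \<delta>"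
    by blast
  then have "\<exists>x. x \<in> E \<and> 0 < norm x \<and> norm x < inverse (real (Suc n)) \<and>
      \<not> ext_dist (x /\<^sub>R norm x) (Allow m ?I) < ereal \<delta>" for n
    by simp
  then obtain X where X: "\<And>n. X n \<in> E" "\<And>n. 0 < norm (X n)" "\<And>n. norm (X n) < inverse (real (Suc n))"
    "\<And>n. \<not> ext_dist (X n /\<^sub>R norm (X n)) (Allow m ?I) < ereal \<delta>" by metis
  have X0: "X \<longlonglongrightarrow> 0"
    using X(3) by (intro Lim_null_comparison[OF _ LIMSEQ_inverse_real_of_nat]) (simp add: less_imp_le)
  define Y where "Y n = X n /\<^sub>R norm (X n)" for n
  have Y1: "Y n \<in> sphere 0 1" for n using X(2)[of n] by (simp add: Y_def)
  have "seq_compact (sphere (0::real^'n) 1)" by (intro compact_imp_seq_compact compact_sphere)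
  then obtain \<omega> s where \<omega>: "\<omega> \<in> sphere 0 1" "strict_mono s" "(Y \<circ> s) \<longlonglongrightarrow> \<omega>"
    using seq_compactE Y1 by metis
  have near: "\<forall>\<^sub>F n in sequentially. dist (Y (s n)) \<omega> < e" if "e > 0" for e
    using tendstoD[OF \<omega>(3) that] by simp
  have Xs0: "(X \<circ> s) \<longlonglongrightarrow> 0" using X0 \<omega>(2) by (rule LIMSEQ_subseq_LIMSEQ)
  have "filterlim (X \<circ> s) (at 0) sequentially"
    unfolding filterlim_at using Xs0 X(2) by (auto intro!: always_eventually)
  then have ev: "\<forall>\<^sub>F n in sequentially. P (X (s n))" if "\<forall>\<^sub>F x in at 0. P x" for P
    using that by (auto simp: filterlim_iff)
  have "\<not> forbidden m ?I \<omega>"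
  proof
    assume "forbidden m ?I \<omega>"
    then obtain L :: nat and p c d r where p: "\<forall>l\<in>{1..L}. p l \<in> ?I" "c > 0" "d > 0" "r > 0"
      "\<forall>x\<in>sector \<omega> d r. (\<Sum>l=1..L. \<bar>p l x\<bar>) > c * norm x ^ m"
      unfolding forbidden_def by blast
    have "\<forall>l\<in>{1..L}. \<exists>g. flat m g \<and> (\<forall>x\<in>E. p l x = g x)"
      using p(1) vanishing_jet_eq_flat_on by blast
    then obtain g where g: "\<And>l. l \<in> {1..L} \<Longrightarrow> flat m (g l)" "\<And>l x. l \<in> {1..L} \<Longrightarrow> x \<in> E \<Longrightarrow> p l x = g l x"
      by metis
    \<comment> \<open>All \<open>L\<close> summands together then stay within
      \<open>c * norm x ^ m\<close>; the successor avoids dividing by 0 when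
      \<open>L = 0\<close>.\<close>
    define e where "e = c / real (Suc L)"
    have e: "e > 0" "real L * e \<le> c" using p(2) by (auto simp: e_def field_simps)
    have "\<forall>\<^sub>F x in at 0. \<forall>l\<in>{1..L}. deriv_bound m (norm x) (e * norm x ^ m) (g l) x"
      using g(1) e(1) by (intro eventually_ball_finite ballI flat_eventually) auto
    from ev[OF this] ev[OF eventually_norm_less[OF p(4)]] near[OF p(3)]
    have "\<forall>\<^sub>F n in sequentially. False"
    proof eventually_elim
      case (elim n)
      let ?x = "X (s n)"
      have "?x \<in> sector \<omega> d r"
        using elim X(2)[of "s n"] by (simp add: sector_def Y_def dist_norm)
      then have "c * norm ?x ^ m < (\<Sum>l=1..L. \<bar>p l ?x\<bar>)" using p(5) by blast
      also have "\<dots> \<le> (\<Sum>l=1..L. e * norm ?x ^ m)"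
        using elim(1) g(2) X(1) by (intro sum_mono) (auto dest!: deriv_bound_value)
      also have "\<dots> = (real L * e) * norm ?x ^ m" by simp
      also have "\<dots> \<le> c * norm ?x ^ m" using e by (intro mult_right_mono) auto
      finally show False by simp
    qed
    then show False by simp
  qed
  then have \<omega>A: "\<omega> \<in> Allow m ?I" using \<omega>(1) by (simp add: Allow_def)
  obtain n where "dist (Y (s n)) \<omega> < \<delta>"
    using near[OF assms] by (auto simp: eventually_sequentially)
  then have "infdist (Y (s n)) (Allow m ?I) < \<delta>"
    using infdist_le[OF \<omega>A, of "Y (s n)"] by simp
  then have "ext_dist (Y (s n)) (Allow m ?I) < ereal \<delta>"
    using \<omega>A by (auto simp: ext_dist_def)
  then show False using X(4) by (simp add: Y_def)
qed

section \<open>Extension of an implied jet at one scale\<close>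

lemma deriv_boundI_multi_deriv:
  assumes "open U" "Cm_on m U f" "x \<in> U"
    and "\<And>\<alpha>. \<alpha> \<in> multi_indices m \<Longrightarrow> \<bar>multi_deriv \<alpha> f x\<bar> \<le> C / \<rho> ^ (\<Sum>i\<in>UNIV. \<alpha> i)"
  shows "deriv_bound m \<rho> C f x"
  unfolding deriv_bound_def
proof (intro allI impI)
  fix "is" :: "'a list" assume l: "length is \<le> m"
  show "\<bar>pderivs is f x\<bar> \<le> C / \<rho> ^ length is"
    using assms(4)[OF count_list_in_multi_indices[OF l]] multi_deriv_eq_pderivs[OF assms(1,2) l assms(3)]
    by (simp add: length_eq_sum_count_list[of "is"])
qed

lemma implied_jet_local_extension:
  fixes E :: "(real^'n::finite) set"
  assumes "implies_jet m (vanishing_jets m E) p" "\<epsilon> > 0"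
  shows "\<exists>r>0. \<forall>\<rho>. 0 < \<rho> \<and> \<rho> \<le> r \<longrightarrow> (\<exists>H. Cm_on m (annulus 2 \<rho>) H \<and>
    (\<forall>x\<in>annulus 2 \<rho>. deriv_bound m \<rho> (\<epsilon> * \<rho> ^ m) H x) \<and> (\<forall>x\<in>annulus 2 \<rho> \<inter> E. H x = p x))"
proof -
  let ?I = "vanishing_jets m E"
  obtain A and L :: nat and Q where A: "A > 0" and Q: "\<forall>l\<in>{1..L}. Q l \<in> ?I" and
    imp: "\<forall>\<epsilon>>0. \<exists>\<delta>>0. \<exists>r>0. \<forall>\<rho>. 0 < \<rho> \<and> \<rho> \<le> r \<longrightarrow>
         (\<exists>F S. Cm_on m (annulus 4 \<rho>) F \<and>
            (\<forall>l\<in>{1..L}. Cm_on m (annulus 4 \<rho>) (S l)) \<and>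
            (\<forall>x\<in>annulus 4 \<rho>. \<forall>\<alpha>\<in>multi_indices m.
               \<bar>multi_deriv \<alpha> F x\<bar> \<le> \<epsilon> * \<rho> ^ (m - (\<Sum>i\<in>UNIV. \<alpha> i))) \<and>
            (\<forall>l\<in>{1..L}. \<forall>x\<in>annulus 4 \<rho>. \<forall>\<alpha>\<in>multi_indices m.
               \<bar>multi_deriv \<alpha> (S l) x\<bar> \<le> A / \<rho> ^ (\<Sum>i\<in>UNIV. \<alpha> i)) \<and>
            (\<forall>x\<in>annulus 2 \<rho>. ext_dist (x /\<^sub>R norm x) (Allow m ?I) < ereal \<delta> \<longrightarrow>
               p x = F x + (\<Sum>l=1..L. S l x * Q l x)))"
    using assms(1) unfolding implies_jet_def by (elim exE conjE) (rule that)
  have "\<forall>l\<in>{1..L}. \<exists>g. Cm_on m UNIV g \<and> flat m g \<and> (\<forall>x\<in>E. Q l x = g x)"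
    using Q vanishing_jet_eq_flat_on by blast
  then obtain g where g: "\<And>l. l \<in> {1..L} \<Longrightarrow> Cm_on m UNIV (g l)" "\<And>l. l \<in> {1..L} \<Longrightarrow> flat m (g l)"
    "\<And>l x. l \<in> {1..L} \<Longrightarrow> x \<in> E \<Longrightarrow> Q l x = g l x"
    by metis
  obtain \<delta> r1 where d: "\<delta> > 0" "r1 > 0" and imp': "\<forall>\<rho>. 0 < \<rho> \<and> \<rho> \<le> r1 \<longrightarrow>
         (\<exists>F S. Cm_on m (annulus 4 \<rho>) F \<and>
            (\<forall>l\<in>{1..L}. Cm_on m (annulus 4 \<rho>) (S l)) \<and>
            (\<forall>x\<in>annulus 4 \<rho>. \<forall>\<alpha>\<in>multi_indices m.
               \<bar>multi_deriv \<alpha> F x\<bar> \<le> \<epsilon> / 2 * \<rho> ^ (m - (\<Sum>i\<in>UNIV. \<alpha> i))) \<and>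
            (\<forall>l\<in>{1..L}. \<forall>x\<in>annulus 4 \<rho>. \<forall>\<alpha>\<in>multi_indices m.
               \<bar>multi_deriv \<alpha> (S l) x\<bar> \<le> A / \<rho> ^ (\<Sum>i\<in>UNIV. \<alpha> i)) \<and>
            (\<forall>x\<in>annulus 2 \<rho>. ext_dist (x /\<^sub>R norm x) (Allow m ?I) < ereal \<delta> \<longrightarrow>
               p x = F x + (\<Sum>l=1..L. S l x * Q l x)))"
    using imp[rule_format, OF half_gt_zero[OF assms(2)]] by (elim exE conjE) (rule that)
  obtain r2 where r2: "r2 > 0" "\<And>x. x \<in> E \<Longrightarrow> 0 < norm x \<Longrightarrow> norm x < r2 \<Longrightarrow>
      ext_dist (x /\<^sub>R norm x) (Allow m ?I) < ereal \<delta>"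
    using direction_near_Allow[OF d(1), of E m] by blast
  \<comment> \<open>\<open>A\<close> bounds the factors \<open>S l\<close>; the powers of 2 come
    from the Leibniz rule, from changing the scale \<open>norm x\<close> to \<rho>, and from
    \<open>norm x < 2 * \<rho>\<close>. Half of \<epsilon> goes to \<open>F\<close>, the other half
    is shared by the products.\<close>
  define B where "B = 2 ^ m * (A * (2 ^ m * 2 ^ m))"
  define e where "e = \<epsilon> / 2 / real (Suc L) / B"
  have B: "B > 0" using A by (simp add: B_def)
  have "B * e = \<epsilon> / 2 / real (Suc L)" using B by (simp add: e_def)
  moreover have "real L * (\<epsilon> / 2 / real (Suc L)) \<le> \<epsilon> / 2"
    using assms(2) by (simp add: divide_le_eq algebra_simps)
  ultimately have e: "e > 0" "real L * (B * e) \<le> \<epsilon> / 2"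
    using B assms(2) by (auto simp: e_def intro!: divide_pos_pos mult_pos_pos)
  have "\<forall>\<^sub>F x in at 0. \<forall>l\<in>{1..L}. deriv_bound m (norm x) (e * norm x ^ m) (g l) x"
    using g(2) e(1) by (intro eventually_ball_finite ballI flat_eventually) auto
  then obtain r3 where r3: "r3 > 0" "\<And>x l. x \<noteq> 0 \<Longrightarrow> norm x < r3 \<Longrightarrow> l \<in> {1..L} \<Longrightarrow>
      deriv_bound m (norm x) (e * norm x ^ m) (g l) x"
    by (auto simp: eventually_at dist_norm)
  \<comment> \<open>Points of \<open>annulus 2 \<rho>\<close> can have norm up to
    \<open>2 * \<rho>\<close>, hence the halved radii.\<close>
  define r where "r = min r1 (min (r2 / 2) (r3 / 2))"
  have "\<exists>H. Cm_on m (annulus 2 \<rho>) H \<and> (\<forall>x\<in>annulus 2 \<rho>. deriv_bound m \<rho> (\<epsilon> * \<rho> ^ m) H x) \<and>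
      (\<forall>x\<in>annulus 2 \<rho> \<inter> E. H x = p x)" if \<rho>: "0 < \<rho>" "\<rho> \<le> r" for \<rho>
  proof -
    have rr: "\<rho> \<le> r1" "2 * \<rho> \<le> r2" "2 * \<rho> \<le> r3" using \<rho> by (auto simp: r_def)
    obtain F S where FS: "Cm_on m (annulus 4 \<rho>) F" "\<forall>l\<in>{1..L}. Cm_on m (annulus 4 \<rho>) (S l)"
        "\<forall>x\<in>annulus 4 \<rho>. \<forall>\<alpha>\<in>multi_indices m.
           \<bar>multi_deriv \<alpha> F x\<bar> \<le> \<epsilon> / 2 * \<rho> ^ (m - (\<Sum>i\<in>UNIV. \<alpha> i))"
        "\<forall>l\<in>{1..L}. \<forall>x\<in>annulus 4 \<rho>. \<forall>\<alpha>\<in>multi_indices m.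
           \<bar>multi_deriv \<alpha> (S l) x\<bar> \<le> A / \<rho> ^ (\<Sum>i\<in>UNIV. \<alpha> i)"
        "\<forall>x\<in>annulus 2 \<rho>. ext_dist (x /\<^sub>R norm x) (Allow m ?I) < ereal \<delta> \<longrightarrow>
           p x = F x + (\<Sum>l=1..L. S l x * Q l x)"
      using imp'[rule_format, OF conjI[OF \<rho>(1) rr(1)]] by (elim exE conjE) (rule that)
    note F = FS(1) and S = FS(2)[rule_format] and Fb = FS(3)[rule_format] and Sb = FS(4)[rule_format]
      and p = FS(5)[rule_format]
    let ?U = "annulus 2 \<rho> :: (real^'n) set"
    have sub: "?U \<subseteq> annulus 4 \<rho>" using \<rho>(1) by (auto simp: annulus_def)
    have x: "x \<noteq> 0" "norm x < 2 * \<rho>" "\<rho> < 2 * norm x" if "x \<in> ?U" for x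
      using that \<rho>(1) by (auto simp: annulus_def)
    note CF = Cm_on_subset[OF F sub] and CS = Cm_on_subset[OF S sub] and Cg = Cm_on_subset[OF g(1) subset_UNIV]
    define H where "H x = F x + (\<Sum>l=1..L. S l x * g l x)" for x
    have "Cm_on m ?U H"
      unfolding H_def by (intro Cm_on_add Cm_on_sum Cm_on_mult open_annulus CF CS Cg)
    moreover have "deriv_bound m \<rho> (\<epsilon> * \<rho> ^ m) H x" if xU: "x \<in> ?U" for x
    proof -
      have x4: "x \<in> annulus 4 \<rho>" using xU sub by blast
      have bF: "deriv_bound m \<rho> (\<epsilon> / 2 * \<rho> ^ m) F x"
      proof (rule deriv_boundI_multi_deriv[OF open_annulus F x4])
        fix \<alpha> :: "'n \<Rightarrow> nat" assume \<alpha>: "\<alpha> \<in> multi_indices m"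
        then have "(\<Sum>i\<in>UNIV. \<alpha> i) \<le> m" by (simp add: multi_indices_def)
        \<comment> \<open>The order is at most \<open>m\<close>, so the subtraction is exact and the
          bound on \<open>F\<close> takes the form used in \<open>deriv_bound\<close>.\<close>
        then have "\<rho> ^ (m - (\<Sum>i\<in>UNIV. \<alpha> i)) = \<rho> ^ m / \<rho> ^ (\<Sum>i\<in>UNIV. \<alpha> i)"
          using \<rho>(1) by (intro power_diff) auto
        then show "\<bar>multi_deriv \<alpha> F x\<bar> \<le> \<epsilon> / 2 * \<rho> ^ m / \<rho> ^ (\<Sum>i\<in>UNIV. \<alpha> i)"
          using Fb[OF x4 \<alpha>] by simp
      qed
      have bS: "deriv_bound m \<rho> A (S l) x" if "l \<in> {1..L}" for l
        by (rule deriv_boundI_multi_deriv[OF open_annulus S[OF that] x4]) (rule Sb[OF that x4])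
      have bg: "deriv_bound m \<rho> (2 ^ m * (e * (2 * \<rho>) ^ m)) (g l) x" if "l \<in> {1..L}" for l
      proof (rule deriv_bound_mono)
        show "deriv_bound m \<rho> (2 ^ m * (e * norm x ^ m)) (g l) x"
          using x[OF xU] rr that \<rho>(1) by (intro deriv_bound_rescale[OF r3(2)]) auto
        show "2 ^ m * (e * norm x ^ m) \<le> 2 ^ m * (e * (2 * \<rho>) ^ m)"
          using x[OF xU] e(1) by (intro mult_left_mono power_mono) auto
      qed (rule \<rho>(1))
      have bSg: "deriv_bound m \<rho> (2 ^ m * (A * (2 ^ m * (e * (2 * \<rho>) ^ m)))) (\<lambda>x. S l x * g l x) x"
        if "l \<in> {1..L}" for l
        by (rule deriv_bound_mult[OF open_annulus xU \<rho>(1) CS[OF that] Cg[OF that] bS[OF that] bg[OF that]])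
      have "deriv_bound m \<rho> (\<Sum>l=1..L. 2 ^ m * (A * (2 ^ m * (e * (2 * \<rho>) ^ m)))) (\<lambda>x. \<Sum>l=1..L. S l x * g l x) x"
        by (intro deriv_bound_sum[OF open_annulus _ xU] \<rho>(1) bSg Cm_on_mult open_annulus CS Cg)
      then have "deriv_bound m \<rho> (real L * (B * e) * \<rho> ^ m) (\<lambda>x. \<Sum>l=1..L. S l x * g l x) x"
        by (simp add: B_def power_mult_distrib mult_ac)
      then have "deriv_bound m \<rho> (\<epsilon> / 2 * \<rho> ^ m) (\<lambda>x. \<Sum>l=1..L. S l x * g l x) x"
        using \<rho>(1) e(2) by (elim deriv_bound_mono) (auto intro!: mult_right_mono)
      then have "deriv_bound m \<rho> (\<epsilon> / 2 * \<rho> ^ m + \<epsilon> / 2 * \<rho> ^ m) H x"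
        unfolding H_def
        by (intro deriv_bound_add[OF open_annulus _ _ xU] CF bF Cm_on_sum Cm_on_mult open_annulus CS Cg)
      then show ?thesis by simp
    qed
    moreover have "H x = p x" if "x \<in> ?U \<inter> E" for x
    proof -
      have "ext_dist (x /\<^sub>R norm x) (Allow m ?I) < ereal \<delta>"
        using that x[of x] rr by (intro r2(2)) auto
      then show ?thesis
        using p[of x] that g(3) by (simp add: H_def)
    qed
    ultimately show ?thesis by blast
  qed
  moreover have "r > 0" using d(2) r2(1) r3(1) by (simp add: r_def)
  ultimately show ?thesis by blast
qed

section \<open>From implied jets to vanishing jets\<close>

lemma implied_jet_is_vanishing_jet:
  fixes E :: "(real^'n::finite) set"
  assumes p: "p \<in> polys0 m" and imp: "implies_jet m (vanishing_jets m E) p"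
  shows "p \<in> vanishing_jets m E"
proof -
  define P where "P \<epsilon> \<rho> H \<longleftrightarrow> Cm_on m (annulus 2 \<rho>) H \<and>
    (\<forall>x\<in>annulus 2 \<rho>. deriv_bound m \<rho> (\<epsilon> * \<rho> ^ m) H x) \<and> (\<forall>x\<in>annulus 2 \<rho> \<inter> E. H x = p x)"
    for \<epsilon> \<rho> H
  have "P \<delta> \<rho> H" if "0 < \<rho>" "P \<epsilon> \<rho> H" "\<epsilon> \<le> \<delta>" for \<epsilon> \<delta> \<rho> H
    using that unfolding P_def by (auto elim!: deriv_bound_mono intro!: mult_right_mono)
  then obtain H where H: "\<And>\<epsilon>. \<epsilon> > 0 \<Longrightarrow> \<exists>r>0. \<forall>\<rho>. 0 < \<rho> \<and> \<rho> \<le> r \<longrightarrow> P \<epsilon> \<rho> (H \<rho>)"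
    using ex_select_uniform[of P] implied_jet_local_extension[OF imp] unfolding P_def by blast
  \<comment> \<open>The value 1 only fixes a range of scales on which \<open>H\<close> is of class
    C^m and agrees with \<open>p\<close> on \<open>E\<close>; smallness near the origin is taken
    from \<open>H\<close> for every \<epsilon>.\<close>
  obtain R where R: "R > 0" "\<And>\<rho>. 0 < \<rho> \<Longrightarrow> \<rho> \<le> R \<Longrightarrow> P 1 \<rho> (H \<rho>)" using H[of 1] by auto
  have "\<exists>G \<psi>. Cm_on m (-{0}) G \<and> flat m G \<and> Cm_on m UNIV \<psi> \<and>
    (\<exists>U. open U \<and> 0 \<in> U \<and> (\<forall>x\<in>U. \<psi> x = 1)) \<and>
    (\<forall>x c. x \<noteq> 0 \<longrightarrow> (\<forall>\<rho>. 0 < \<rho> \<and> \<rho> \<le> R \<and> x \<in> annulus 2 \<rho> \<longrightarrow> H \<rho> x = c) \<longrightarrow> G x = \<psi> x * c)"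
  proof (rule ex_dyadic_glue[OF R(1)])
    show "Cm_on m (annulus 2 \<rho>) (H \<rho>)" if "0 < \<rho>" "\<rho> \<le> R" for \<rho>
      using R(2)[OF that] by (simp add: P_def)
    show "\<exists>r>0. \<forall>\<rho>. 0 < \<rho> \<and> \<rho> \<le> r \<longrightarrow> (\<forall>x\<in>annulus 2 \<rho>. deriv_bound m \<rho> (\<epsilon> * \<rho> ^ m) (H \<rho>) x)"
      if "\<epsilon> > 0" for \<epsilon>
      using H[OF that] unfolding P_def by blast
  qed
  then obtain G \<psi> U where G: "Cm_on m (-{0}) G" "flat m G" and \<psi>: "Cm_on m UNIV \<psi>"
    and U: "open U" "0 \<in> U" "\<And>x. x \<in> U \<Longrightarrow> \<psi> x = 1"
    and eq: "\<And>x c. x \<noteq> 0 \<Longrightarrow> (\<forall>\<rho>. 0 < \<rho> \<and> \<rho> \<le> R \<and> x \<in> annulus 2 \<rho> \<longrightarrow> H \<rho> x = c) \<Longrightarrow> G x = \<psi> x * c"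
    by blast
  note GC = flat_imp_Cm_on[OF G]
  have pp: "p \<in> polys m" "p 0 = 0" using p by (auto simp: polys0_def)
  have pC: "Cm_on m UNIV p" using pp(1) by (rule Cm_on_polys[OF open_UNIV])
  \<comment> \<open>The cutoff multiplies \<open>p\<close> alone: on \<open>E\<close> the gluing
    already yields \<open>G = \<psi> * p\<close>, at every distance from the origin. Near the origin
    \<open>f\<close> is \<open>p - G\<close>.\<close>
  define f where "f x = \<psi> x * p x - G x" for x
  have fC: "Cm_on m UNIV f"
    unfolding f_def by (intro Cm_on_diff Cm_on_mult \<psi> pC GC open_UNIV)
  have "f x = 0" if "x \<in> E" for x
  proof (cases "x = 0")
    case True
    then show ?thesis using pp(2) G(2) by (simp add: f_def flat_def)
  next
    case False
    have "G x = \<psi> x * p x" using R(2) that by (intro eq[OF False]) (auto simp: P_def)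
    then show ?thesis by (simp add: f_def)
  qed
  moreover have "jet m f = p"
  proof (rule jet_eqI[OF open_UNIV fC UNIV_I pp(1)])
    fix "is" :: "'n list" assume l: "length is \<le> m"
    have "pderivs is f 0 = pderivs is (\<lambda>x. p x - G x) 0"
      by (rule pderivs_cong[OF U(1,2)]) (simp add: f_def U(3))
    then show "pderivs is f 0 = pderivs is p 0"
      using pderivs_diff[OF open_UNIV pC GC(1) l UNIV_I] GC(2)[OF l] by simp
  qed
  ultimately show ?thesis using fC by (auto simp: vanishing_jets_def)
qed

text \<open>The representation \<open>p = 0 + 1 * p\<close> works at all scales: one generator
  \<open>p\<close> with constant coefficient 1, no error term, and \<open>A = 1\<close>.\<close>

lemma implies_jet_of_mem:
  fixes I :: "(real^'n::finite \<Rightarrow> real) set"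
  assumes "p \<in> I"
  shows "implies_jet m I p"
proof -
  have md: "multi_deriv \<alpha> (\<lambda>x. c) x = (if (\<Sum>i\<in>UNIV. \<alpha> i) = 0 then c else 0)"
    for \<alpha> :: "'n \<Rightarrow> nat" and c and x :: "real^'n"
  proof -
    obtain "is" where "is": "\<alpha> = count_list is"
      using multi_index_list[of \<alpha> "\<Sum>i\<in>UNIV. \<alpha> i"] by (auto simp: multi_indices_def)
    have "multi_deriv \<alpha> (\<lambda>x. c) x = pderivs is (\<lambda>x. c) x"
      unfolding "is" by (rule multi_deriv_eq_pderivs[OF open_UNIV Cm_on_const order_refl UNIV_I])
    then show ?thesis
      unfolding "is" length_eq_sum_count_list[symmetric] by (simp add: pderivs_const)
  qed
  show ?thesis
    unfolding implies_jet_def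
  proof (rule exI[of _ 1], rule conjI, simp, rule exI[of _ 1], rule exI[of _ "\<lambda>_. p"],
      intro conjI allI impI)
    fix \<epsilon> :: real assume "\<epsilon> > 0"
    then show "\<exists>\<delta>>0. \<exists>r>0. \<forall>\<rho>. 0 < \<rho> \<and> \<rho> \<le> r \<longrightarrow>
         (\<exists>F S. Cm_on m (annulus 4 \<rho>) F \<and>
            (\<forall>l\<in>{1..1::nat}. Cm_on m (annulus 4 \<rho>) (S l)) \<and>
            (\<forall>x\<in>annulus 4 \<rho>. \<forall>\<alpha>\<in>multi_indices m.
               \<bar>multi_deriv \<alpha> F x\<bar> \<le> \<epsilon> * \<rho> ^ (m - (\<Sum>i\<in>UNIV. \<alpha> i))) \<and>
            (\<forall>l\<in>{1..1}. \<forall>x\<in>annulus 4 \<rho>. \<forall>\<alpha>\<in>multi_indices m.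
               \<bar>multi_deriv \<alpha> (S l) x\<bar> \<le> 1 / \<rho> ^ (\<Sum>i\<in>UNIV. \<alpha> i)) \<and>
            (\<forall>x\<in>annulus 2 \<rho>. ext_dist (x /\<^sub>R norm x) (Allow m I) < ereal \<delta> \<longrightarrow>
               p x = F x + (\<Sum>l=1..1. S l x * p x)))"
      by (intro exI[of _ 1] conjI allI impI exI[of _ "\<lambda>_. 0 :: real"] exI[of _ "\<lambda>_ _. 1 :: real"])
        (auto simp: md)
  qed (use assms in auto)
qed

theorem theorem2p18:
  fixes m :: nat and E :: "(real^'n::finite) set"
  assumes "m \<ge> 1" and "closed E" and "0 \<in> E"
  shows "vanishing_jets m E = jet_closure m (vanishing_jets m E)"
proof
  show "vanishing_jets m E \<subseteq> jet_closure m (vanishing_jets m E)"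
  proof
    fix p assume p: "p \<in> vanishing_jets m E"
    then obtain f where f: "p = jet m f" "Cm_on m UNIV f" "\<forall>x\<in>E. f x = 0"
      by (auto simp: vanishing_jets_def)
    \<comment> \<open>The empty list of derivatives evaluates at the origin, where \<open>f\<close>
      vanishes because 0 belongs to \<open>E\<close>.\<close>
    have "p 0 = 0"
      using pderivs_jet_zero[OF open_UNIV f(2) UNIV_I, of "[]"] f assms(3) by simp
    then have "p \<in> polys0 m" using jet_in_polys f(1) by (auto simp: polys0_def)
    then show "p \<in> jet_closure m (vanishing_jets m E)"
      using implies_jet_of_mem[OF p] by (simp add: jet_closure_def)
  qed
  show "jet_closure m (vanishing_jets m E) \<subseteq> vanishing_jets m E"
    using implied_jet_is_vanishing_jet by (auto simp: jet_closure_def)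
qed

end
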